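(* Let $q>1$ and $\eta\ge 0$ be such that either $q\in(1,2]$, or $q>2$, the eigenvalues of the matrices considered are bounded by some $\Lambda<\infty$, and $\eta\ge u_{\mathrm{zero}}(q)\Lambda^{q-1}$. Fix $\mu>0$, let $X^{*}=X^{*}(b)$ be the central-path point at parameter $\mu$ for the barrier $\phi_{q,\eta}$ and right-hand side $b$, let $M:=\nabla^2\phi_{q,\eta}(X^{*})$, and let $\lambda_1\ge\dots\ge\lambda_n>0$ be the eigenvalues of $X^{*}$. For every perturbation $\Delta b\in\mathbb{R}^m$, $$\|X^{*}(b+\Delta b)-X^{*}(b)\|_{F}\ \le\ \frac{C_{\mathcal{A}}}{\mu}\cdot\frac{\lambda_{\max}(X^{*})^{2}}{1+\eta q\,\lambda_{\max}(X^{*})^{-(q-1)}}\,\|\Delta b\|_2+o(\|\Delta b\|_2),$$ where $C_{\mathcal{A}}>0$ depends on $\mathcal{A}$ and $\lambda_{\min}(X^{*})$. This bound is strictly smaller than the $\eta=0$ bound $C_{\mathcal{A}}\mu^{-1}\lambda_{\max}^{2}\|\Delta b\|_2$ for every $\eta>0$. Moreover, in each eigendirection $H=e_ke_k^{\top}$ of $X^{*}$, $$\bigl|[\Delta X]_{kk}\bigr|\ \le\ \frac{C_{\mathcal{A}}^{(k)}}{\mu}\cdot\frac{\lambda_k^{2}}{1+\eta q\,\lambda_k^{-(q-1)}}\,\|\Delta b\|_2,$$ and, for $\eta>0$, as $\lambda_k\to 0^{+}$, $$\frac{\lambda_k^{2}}{1+\eta q\,\lambda_k^{-(q-1)}}\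 \sim\ \frac{\lambda_k^{q+1}}{\eta q}\ \longrightarrow\ 0,$$ at rate $q+1>2$, strictly faster than the $\eta=0$ rate of $2$. The bound recovers the log-det sensitivity as $\eta\to 0^{+}$ or $q\to 1^{+}$.
   Context: $\mathbb{S}^n$ is the space of real symmetric $n\times n$ matrices, with inner product $\langle A,B\rangle=\operatorname{tr}(A^\top B)$ and Frobenius norm $\|\cdot\|_F$; $\mathbb{S}^n_{++}$ is the set of positive definite matrices. For $q>1,\eta\ge0$, $\phi_{q,\eta}(X)=-\log\det(X)+\frac{\eta}{q-1}[\operatorname{tr}(X^{-(q-1)})-n]$ on $\mathbb{S}^n_{++}$; $\eta=0$ gives the log-det barrier. Its gradient is $\nabla\phi_{q,\eta}(X)=-X^{-1}-\eta X^{-q}$. The semidefinite program is $\min\langle C,X\rangle$ subject to $\mathcal{A}(X)=b$, $X\succeq0$, with $\mathcal{A}:\mathbb{S}^n\to\mathbb{R}^m$ linear with adjoint $\mathcal{A}^{*}$, $b\in\mathbb{R}^m$, $C\in\mathbb{S}^n$. The central-path point $X^{*}(b)\in\mathbb{S}^n_{++}$ at parameter $\mu>0$ is the solution, together with some $y^{*}\in\mathbb{R}^m$, of $$C+\mu\nabla\phi_{q,\eta}(X^{*})+\mathcal{A}^{*}(y^{*})=0,\qquad \mathcal{A}(X^{*})=b,$$ assumed to exist for the right-hand sides considered. $\Delta X$ denotes the first-order response of $X^{*}(b)$ to the perturbation $\Delta b$, i.e. the solution (with some $\Delta y$) of $\mu M[\Delta X]+\mathcal{A}^{*}(\Delta y)=0$,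 $\mathcal{A}(\Delta X)=\Delta b$; $[\Delta X]_{kk}$ is its $k$-th diagonal entry in the eigenbasis of $X^{*}$ in which $X^*=\operatorname{diag}(\lambda_1,\dots,\lambda_n)$, and $e_k$ is the eigenvector for $\lambda_k$. $C^{(k)}_{\mathcal{A}}>0$ is a constant of the same kind as $C_{\mathcal{A}}$, for the $k$-th direction. $u_{\mathrm{zero}}(q)=\frac{[(q-1)+\sqrt{(q-1)(q+7)}]^2-16}{16q}$.
   Formalization: The constants may also depend on q, η, μ (independence fails for n=m=1, A=id); "recovers the log-det sensitivity" is stated for bounds with such constants, and for a fixed constant the q→1+ limit is corrected by the factor 1/(1+η). *)

theory Defs
  imports "HOL-Analysis.Analysis" "HOL-Library.Landau_Symbols"
begin

section \<open>The Euclidean space of real symmetric matrices\<close>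

text \<open>
  The space of symmetric matrices is made a type of class \<^class>\<open>euclidean_space\<close>, so that
  \<^const>\<open>linear\<close>, \<^const>\<open>adjoint\<close>, gradients and Frechet derivatives are all the
  library ones, taken relative to symmetric matrices.
\<close>

typedef ('n::finite) sym_mat = "{X :: real^'n^'n. transpose X = X}"
  morphisms mat_of Sym_mat
  by (rule exI[of _ "mat 1"]) (simp add: transpose_mat)

setup_lifting type_definition_sym_mat

lemma transpose_mat_of [simp]: "transpose (mat_of X) = mat_of X"
  using mat_of[of X] by simp

lemma transpose_add_mat: "transpose (A + B) = transpose A + transpose (B :: real^'n^'m)"
  by (simp add: transpose_def vec_eq_iff)

lemma transpose_scaleR_mat: "transpose (c *\<^sub>R A) = c *\<^sub>R transpose (A :: real^'n^'m)"
  by (simp add: transpose_def vec_eq_iff)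

lemma transpose_minus_mat: "transpose (- A) = - transpose (A :: real^'n^'m)"
  by (simp add: transpose_def vec_eq_iff)

lemma transpose_diff_mat: "transpose (A - B) = transpose A - transpose (B :: real^'n^'m)"
  by (simp add: transpose_def vec_eq_iff)

lemma transpose_zero_mat: "transpose 0 = (0 :: real^'n^'m)"
  by (simp add: transpose_def vec_eq_iff)

instantiation sym_mat :: (finite) real_vector
begin

lift_definition zero_sym_mat :: "'a sym_mat" is 0
  by (rule transpose_zero_mat)
lift_definition plus_sym_mat :: "'a sym_mat \<Rightarrow> 'a sym_mat \<Rightarrow> 'a sym_mat" is "(+)"
  by (simp add: transpose_add_mat)
lift_definition minus_sym_mat :: "'a sym_mat \<Rightarrow> 'a sym_mat \<Rightarrow> 'a sym_mat" is "(-)"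
  by (simp add: transpose_diff_mat)
lift_definition uminus_sym_mat :: "'a sym_mat \<Rightarrow> 'a sym_mat" is uminus
  by (simp add: transpose_minus_mat)
lift_definition scaleR_sym_mat :: "real \<Rightarrow> 'a sym_mat \<Rightarrow> 'a sym_mat" is scaleR
  by (simp add: transpose_scaleR_mat)

instance
  by (standard; transfer; simp add: algebra_simps)

end

instantiation sym_mat :: (finite) real_inner
begin

text \<open>Inherited from the ambient space of matrices: trace inner product, Frobenius norm.\<close>

lift_definition inner_sym_mat :: "'a sym_mat \<Rightarrow> 'a sym_mat \<Rightarrow> real" is inner .
lift_definition norm_sym_mat :: "'a sym_mat \<Rightarrow> real" is norm .

definition sgn_sym_mat :: "'a sym_mat \<Rightarrow> 'a sym_mat"
  where "sgn_sym_mat X = inverse (norm X) *\<^sub>R X"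
definition dist_sym_mat :: "'a sym_mat \<Rightarrow> 'a sym_mat \<Rightarrow> real"
  where "dist_sym_mat X Y = norm (X - Y)"
definition uniformity_sym_mat :: "('a sym_mat \<times> 'a sym_mat) filter"
  where "uniformity_sym_mat = (INF e\<in>{0<..}. principal {(X, Y). dist X Y < e})"
definition open_sym_mat :: "'a sym_mat set \<Rightarrow> bool"
  where "open_sym_mat U \<longleftrightarrow>
    (\<forall>X\<in>U. eventually (\<lambda>(X', Y). X' = X \<longrightarrow> Y \<in> U) uniformity)"

instance
proof
  fix X Y Z :: "'a sym_mat" and r :: real and U :: "'a sym_mat set"
  show "dist X Y = norm (X - Y)" by (rule dist_sym_mat_def)
  show "sgn X = inverse (norm X) *\<^sub>R X" by (rule sgn_sym_mat_def)
  show "uniformity = (INF e\<in>{0<..}. principal {(X :: 'a sym_mat, Y). dist X Y < e})"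
    by (rule uniformity_sym_mat_def)
  show "open U \<longleftrightarrow> (\<forall>X\<in>U. eventually (\<lambda>(X', Y). X' = X \<longrightarrow> Y \<in> U) uniformity)"
    by (rule open_sym_mat_def)
  show "inner X Y = inner Y X" by transfer (rule inner_commute)
  show "inner (X + Y) Z = inner X Z + inner Y Z" by transfer (rule inner_add_left)
  show "inner (r *\<^sub>R X) Y = r * inner X Y" by transfer (rule inner_scaleR_left)
  show "0 \<le> inner X X" by transfer simp
  show "inner X X = 0 \<longleftrightarrow> X = 0" by transfer simp
  show "norm X = sqrt (inner X X)" by transfer (rule norm_eq_sqrt_inner)
qed

end

lemma inner_sym_mat_trace: "inner X Y = trace (transpose (mat_of X) ** mat_of Y)"
proof -
  have "inner X Y = (\<Sum>i\<in>UNIV. \<Sum>j\<in>UNIV. mat_of X $ i $ j * mat_of Y $ i $ j)"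
    by transfer (simp add: inner_vec_def)
  also have "\<dots> = (\<Sum>j\<in>UNIV. \<Sum>i\<in>UNIV. mat_of X $ i $ j * mat_of Y $ i $ j)"
    by (rule sum.swap)
  finally show ?thesis
    unfolding trace_def matrix_matrix_mult_def transpose_def by simp
qed

lemma sym_mat_orthonormal_basis:
  "\<exists>B :: ('n::finite) sym_mat set. B \<noteq> {} \<and> finite B \<and>
     (\<forall>u\<in>B. \<forall>v\<in>B. inner u v = (if u = v then 1 else 0)) \<and>
     (\<forall>x. (\<forall>u\<in>B. inner x u = 0) \<longleftrightarrow> x = 0)"
proof -
  let ?S = "{X :: real^'n^'n. transpose X = X}"
  have sub: "subspace ?S"
    by (simp add: subspace_def transpose_zero_mat transpose_add_mat transpose_scaleR_mat)
  obtain C where C: "C \<subseteq> ?S" "pairwise orthogonal C" "\<And>x. x \<in> C \<Longrightarrow> norm x = 1"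
    "independent C" "card C = dim ?S" "span C = ?S"
    by (rule orthonormal_basis_subspace[OF sub]) (rule that)
  have fin: "finite C" using C(4) by (rule independent_imp_finite)
  have im: "mat_of ` (Sym_mat ` C) = C"
  proof -
    have "mat_of (Sym_mat x) = x" if "x \<in> C" for x
      using C(1) that by (intro Sym_mat_inverse) blast
    then show ?thesis by (simp add: image_image)
  qed
  have mem: "mat_of u \<in> C" if "u \<in> Sym_mat ` C" for u
    using imageI[OF that, of mat_of] unfolding im .
  have inner_C: "inner (mat_of u) (mat_of v) = (if u = v then 1 else 0)"
    if "u \<in> Sym_mat ` C" "v \<in> Sym_mat ` C" for u v
  proof (cases "u = v")
    case True
    have "norm (mat_of u) = 1" using C(3) mem[OF that(1)] .
    then show ?thesis using True by (simp add: norm_eq_1)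
  next
    case False
    then have "mat_of u \<noteq> mat_of v" by (simp add: mat_of_inject)
    then have "orthogonal (mat_of u) (mat_of v)"
      using pairwiseD[OF C(2) mem[OF that(1)] mem[OF that(2)]] by simp
    then show ?thesis using False by (simp add: orthogonal_def)
  qed
  have zero: "x = 0" if x: "\<forall>u\<in>Sym_mat ` C. inner x u = 0" for x :: "'n sym_mat"
  proof -
    have orth: "orthogonal (mat_of x) y" if y: "y \<in> C" for y
    proof -
      obtain u where u: "u \<in> Sym_mat ` C" "y = mat_of u"
        using equalityD2[OF im, THEN subsetD, OF y] by (rule imageE)
      then show ?thesis using bspec[OF x u(1)] by (simp add: inner_sym_mat.rep_eq orthogonal_def)
    qed
    have "mat_of x \<in> span C" unfolding C(6) by (rule mat_of)
    then have "orthogonal (mat_of x) (mat_of x)"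
      by (rule orthogonal_to_span) (rule orth)
    then have "mat_of x = mat_of 0" by (simp add: orthogonal_def zero_sym_mat.rep_eq)
    then show ?thesis by (simp only: mat_of_inject)
  qed
  have ne: "C \<noteq> {}"
  proof
    assume "C = {}"
    then have "?S = {0}" using C(6) by (simp only: span_empty)
    then have "(mat 1 :: real^'n^'n) = 0" by (metis (mono_tags) mem_Collect_eq singletonD transpose_mat)
    then have "(mat 1 :: real^'n^'n) $ undefined $ undefined = 0" by simp
    then show False by (simp add: mat_def)
  qed
  show ?thesis
  proof (intro exI[of _ "Sym_mat ` C"] conjI ballI allI iffI)
    show "Sym_mat ` C \<noteq> {}" using ne by simp
    show "finite (Sym_mat ` C)" using fin by simp
    show "inner u v = (if u = v then 1 else 0)" if "u \<in> Sym_mat ` C" "v \<in> Sym_mat ` C" for u v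
      unfolding inner_sym_mat.rep_eq using that by (rule inner_C)
    show "x = 0" if "\<forall>u\<in>Sym_mat ` C. inner x u = 0" for x
      using that by (rule zero)
    show "inner x u = 0" if "x = 0" for x u :: "'n sym_mat"
      using that by simp
  qed
qed

instantiation sym_mat :: (finite) euclidean_space
begin

definition Basis_sym_mat :: "'a sym_mat set"
  where "Basis_sym_mat = (SOME B. B \<noteq> {} \<and> finite B \<and>
     (\<forall>u\<in>B. \<forall>v\<in>B. inner u v = (if u = v then 1 else 0)) \<and>
     (\<forall>x. (\<forall>u\<in>B. inner x u = 0) \<longleftrightarrow> x = 0))"

instance
proof
  note B = someI_ex[OF sym_mat_orthonormal_basis[where 'n = 'a], folded Basis_sym_mat_def]
  show "Basis \<noteq> ({} :: 'a sym_mat set)" "finite (Basis :: 'a sym_mat set)"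
    using B by blast+
  show "inner u v = (if u = v then 1 else 0)" if "u \<in> Basis" "v \<in> Basis" for u v :: "'a sym_mat"
    using B that by blast
  show "(\<forall>u\<in>Basis. inner x u = 0) \<longleftrightarrow> x = 0" for x :: "'a sym_mat"
    using B by blast
qed

end

section \<open>Spectral notions\<close>

definition pos_def :: "('n::finite) sym_mat \<Rightarrow> bool"
  where "pos_def X \<longleftrightarrow> (\<forall>v. v \<noteq> 0 \<longrightarrow> v \<bullet> (mat_of X *v v) > 0)"

definition eigenvalues :: "('n::finite) sym_mat \<Rightarrow> real set"
  where "eigenvalues X = {l. \<exists>v. v \<noteq> 0 \<and> mat_of X *v v = l *\<^sub>R v}"

definition lambda_max :: "('n::finite) sym_mat \<Rightarrow> real"
  where "lambda_max X = Max (eigenvalues X)"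

definition lambda_min :: "('n::finite) sym_mat \<Rightarrow> real"
  where "lambda_min X = Min (eigenvalues X)"

text \<open>
  An orthonormal eigenbasis \<open>e\<close> of \<open>X\<close> with eigenvalues \<open>lam\<close>, listed with multiplicity and
  indexed by \<open>'n\<close>. Any labelling of the eigenvalues is allowed, in particular a nonincreasing one.
\<close>

definition eigenbasis :: "('n::finite) sym_mat \<Rightarrow> ('n \<Rightarrow> real) \<Rightarrow> ('n \<Rightarrow> real^'n) \<Rightarrow> bool"
  where "eigenbasis X lam e \<longleftrightarrow>
    (\<forall>i j. e i \<bullet> e j = (if i = j then 1 else 0)) \<and>
    (\<forall>k. mat_of X *v e k = lam k *\<^sub>R e k)"

text \<open>
  \<open>f(X) = (\<Sum>k. f(lam k) e\<^sub>k e\<^sub>k\<^sup>T)\<close>; the value does not depend on the chosen eigenbasis.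
\<close>

definition spectral_fun :: "(real \<Rightarrow> real) \<Rightarrow> ('n::finite) sym_mat \<Rightarrow> 'n sym_mat"
  where "spectral_fun f X = (THE Y. \<exists>lam e. eigenbasis X lam e \<and>
    mat_of Y = (\<chi> i j. \<Sum>k\<in>UNIV. f (lam k) * e k $ i * e k $ j))"

definition sym_powr :: "('n::finite) sym_mat \<Rightarrow> real \<Rightarrow> 'n sym_mat"
  where "sym_powr X p = spectral_fun (\<lambda>x. x powr p) X"

section \<open>Gradient, Hessian, barrier and central path\<close>

definition gradient :: "('a::real_inner \<Rightarrow> real) \<Rightarrow> 'a \<Rightarrow> 'a"
  where "gradient f x = (THE D. GDERIV f x :> D)"

definition hessian :: "('a::real_inner \<Rightarrow> real) \<Rightarrow> 'a \<Rightarrow> 'a \<Rightarrow> 'a"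
  where "hessian f x = frechet_derivative (gradient f) (at x)"

text \<open>Only the values on positive definite matrices, which form an open set, are meaningful.\<close>

definition barrier :: "real \<Rightarrow> real \<Rightarrow> ('n::finite) sym_mat \<Rightarrow> real"
  where "barrier q \<eta> X = - ln (det (mat_of X))
    + \<eta> / (q - 1) * (trace (mat_of (sym_powr X (- (q - 1)))) - real CARD('n))"

definition central_point ::
  "real \<Rightarrow> real \<Rightarrow> real \<Rightarrow> ('n::finite sym_mat \<Rightarrow> real^'m::finite) \<Rightarrow> 'n sym_mat \<Rightarrow>
    real^'m \<Rightarrow> 'n sym_mat \<Rightarrow> bool"
  where "central_point q \<eta> \<mu> \<A> C b X \<longleftrightarrow> pos_def X \<and>
    (\<exists>y. C + \<mu> *\<^sub>R gradient (barrier q \<eta>) X + adjoint \<A> y = 0) \<and> \<A> X = b"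

definition response ::
  "real \<Rightarrow> ('n::finite sym_mat \<Rightarrow> real^'m::finite) \<Rightarrow> ('n sym_mat \<Rightarrow> 'n sym_mat) \<Rightarrow>
    real^'m \<Rightarrow> 'n sym_mat \<Rightarrow> bool"
  where "response \<mu> \<A> M \<Delta>b \<Delta>X \<longleftrightarrow>
    (\<exists>\<Delta>y. \<mu> *\<^sub>R M \<Delta>X + adjoint \<A> \<Delta>y = 0) \<and> \<A> \<Delta>X = \<Delta>b"

definition u_zero :: "real \<Rightarrow> real"
  where "u_zero q = (((q - 1) + sqrt ((q - 1) * (q + 7)))\<^sup>2 - 16) / (16 * q)"

definition sens_factor :: "real \<Rightarrow> real \<Rightarrow> real \<Rightarrow> real"
  where "sens_factor q \<eta> l = l\<^sup>2 / (1 + \<eta> * q * l powr (- (q - 1)))"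

end

theory Submission
  imports Defs
begin

text \<open>
  On the eigenvalue scale the gradient of the barrier is the increasing function
  \<open>g(x) = - 1 / x - \<eta> x powr - q\<close>, and the sensitivity factor \<open>\<lambda>\<^sup>2 / (1 + \<eta> q \<lambda> powr - (q - 1))\<close> is
  exactly \<open>1 / g'(\<lambda>)\<close>. Because \<open>g'\<close> decreases, the Hessian at \<open>X\<^sup>*\<close> lies between \<open>g'(\<lambda>\<^sub>m\<^sub>a\<^sub>x)\<close> and
  \<open>g'(\<lambda>\<^sub>m\<^sub>i\<^sub>n)\<close>. The difference of two central gradients is orthogonal to the kernel of the constraint
  map, so the displacement of the central point is controlled by a fixed bounded preimage \<open>H\<close> of
  \<open>\<Delta>b\<close>, up to the condition number \<open>g'(\<lambda>\<^sub>m\<^sub>i\<^sub>n) / g'(\<lambda>\<^sub>m\<^sub>a\<^sub>x)\<close>. With \<open>g'(\<lambda>\<^sub>m\<^sub>i\<^sub>n)\<close> and the norm of the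
  lifting absorbed into the constant, what remains is the sensitivity factor at \<open>\<lambda>\<^sub>m\<^sub>a\<^sub>x\<close>. For a
  diagonal entry of the response the same energy comparison applies with \<open>g'(\<lambda>\<^sub>k)\<close> in place of
  \<open>g'(\<lambda>\<^sub>m\<^sub>a\<^sub>x)\<close>.

  The analytic tool is the identity \<open>bform_spectral_fun_diff\<close>: if \<open>e\<close> and \<open>d\<close> are eigenbases of \<open>X\<close> and
  \<open>Y\<close> with eigenvalues \<open>\<lambda>\<close> and \<open>\<mu>\<close>, then
  \<open>e\<^sub>i \<bullet> (f(X) - f(Y)) d\<^sub>j = f[\<lambda>\<^sub>i, \<mu>\<^sub>j] (e\<^sub>i \<bullet> (X - Y) d\<^sub>j)\<close>, where \<open>f[x, y]\<close> is the divided difference.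
  It yields global monotonicity and local strong monotonicity and Lipschitz bounds of the gradient
  (\<open>inner_barrier_gradient_diff\<close>), and also the derivative of \<open>f\<close> as a function of a symmetric matrix
  (\<open>spectral_fun_has_derivative\<close>), from which the gradient and the Hessian of the barrier follow.

  The finite estimate for central points (\<open>central_point_locally_lipschitz\<close>) works with increments
  of the gradient directly, by way of \<open>strongly_monotone_lipschitz_inverse\<close>, rather than through an
  implicit function theorem. It therefore holds for every selection of central points over an
  arbitrary set of right-hand sides, and the remainder term even vanishes near \<open>\<Delta>b = 0\<close>.
\<close>

section \<open>Symmetric matrices as bilinear forms\<close>

definition bform :: "('n::finite) sym_mat \<Rightarrow> real^'n \<Rightarrow> real^'n \<Rightarrow> real"
  where "bform A u v = u \<bullet> (mat_of A *v v)"

definition orthonormal :: "('n::finite \<Rightarrow> real^'n) \<Rightarrow> bool"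
  where "orthonormal e \<longleftrightarrow> (\<forall>i j. e i \<bullet> e j = (if i = j then 1 else 0))"

lemma bform_commute: "bform A u v = bform A v u"
proof -
  have "mat_of A *v v = v v* mat_of A"
    using transpose_matrix_vector[of "mat_of A" v] by simp
  then show ?thesis
    by (simp add: bform_def dot_lmul_matrix inner_commute[of u])
qed

lemma bform_linear:
  "bform A (u + u') v = bform A u v + bform A u' v"
  "bform A (u - u') v = bform A u v - bform A u' v"
  "bform A (c *\<^sub>R u) v = c * bform A u v"
  "bform A u (v + v') = bform A u v + bform A u v'"
  "bform A u (v - v') = bform A u v - bform A u v'"
  "bform A u (c *\<^sub>R v) = c * bform A u v"
  "bform (A + B) u v = bform A u v + bform B u v"
  "bform (c *\<^sub>R A) u v = c * bform A u v"
  by (simp_all add: bform_def plus_sym_mat.rep_eq scaleR_sym_mat.rep_eq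
      inner_add inner_diff matrix_vector_right_distrib matrix_vector_mult_add_rdistrib
      matrix_vector_mult_diff_distrib matrix_vector_mult_scaleR scaleR_matrix_vector_assoc[symmetric])

lemma bform_minus: "bform (A - B) u v = bform A u v - bform B u v"
  by (simp add: bform_def minus_sym_mat.rep_eq inner_diff matrix_vector_mult_diff_rdistrib)

lemmas bform_simps = bform_linear bform_minus

section \<open>The spectral theorem\<close>

text \<open>
  A maximiser \<open>v\<close> of the quadratic form on the unit sphere of \<open>S\<close> is an eigenvector: its residual
  \<open>c v - A v\<close> lies in \<open>S\<close> by invariance, and moving \<open>v\<close> against that direction would increase the
  Rayleigh quotient unless the residual vanishes.
\<close>

lemma eigenvector_in_invariant_subspace:
  fixes A :: "('n::finite) sym_mat"
  assumes S: "subspace S" and inv: "\<And>v. v \<in> S \<Longrightarrow> mat_of A *v v \<in> S" and ne: "u \<in> S" "u \<noteq> 0"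
  obtains v c where "v \<in> S" "norm v = 1" "mat_of A *v v = c *\<^sub>R v"
proof -
  let ?K = "sphere 0 1 \<inter> S"
  have "compact ?K"
    by (intro compact_Int_closed closed_subspace S) auto
  moreover have "(1 / norm u) *\<^sub>R u \<in> ?K"
    using ne subspace_scale[OF S ne(1)] by auto
  moreover have "continuous_on ?K (\<lambda>v. bform A v v)"
    unfolding bform_def by (intro continuous_intros linear_continuous_on_compose[OF _ matrix_vector_mul_linear])
  ultimately obtain v where v: "v \<in> ?K" and max: "\<And>w. w \<in> ?K \<Longrightarrow> bform A w w \<le> bform A v v"
    using continuous_attains_sup[of ?K "\<lambda>v. bform A v v"] by blast
  define c where "c = bform A v v"
  have vv: "v \<bullet> v = 1" "norm v = 1" "v \<in> S" using v by (auto simp: norm_eq_1)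
  have Q: "bform A w w \<le> c * (w \<bullet> w)" if w: "w \<in> S" for w
  proof (cases "w = 0")
    case False
    have "(1 / norm w) *\<^sub>R w \<in> ?K"
      using False subspace_scale[OF S w] by auto
    from max[OF this] have "bform A w w / (norm w * norm w) \<le> c"
      by (simp add: bform_simps c_def)
    then show ?thesis using False
      by (simp add: field_simps power2_norm_eq_inner[symmetric] power2_eq_square)
  qed (simp add: bform_def)
  define u' where "u' = c *\<^sub>R v - mat_of A *v v"
  have u': "u' \<in> S" unfolding u'_def by (intro subspace_diff S subspace_scale inv vv)
  (* The form c|w|^2 - w.Aw is nonnegative on S and vanishes at v, so its derivative at v in the
     direction u', which is 2|u'|^2, vanishes as well. *)
  have quad: "0 \<le> 2 * t * (u' \<bullet> u') + t\<^sup>2 * (c * (u' \<bullet> u') - bform A u' u')" for t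
  proof -
    have "v + t *\<^sub>R u' \<in> S" by (intro subspace_add S subspace_scale vv u')
    from Q[OF this] have "0 \<le> c * ((v + t *\<^sub>R u') \<bullet> (v + t *\<^sub>R u')) - bform A (v + t *\<^sub>R u') (v + t *\<^sub>R u')"
      by simp
    also have "\<dots> = 2 * t * (c * (u' \<bullet> v) - bform A u' v) + t\<^sup>2 * (c * (u' \<bullet> u') - bform A u' u')"
      by (simp add: bform_simps inner_add vv c_def[symmetric] bform_commute[of A v u'] inner_commute[of v u']
          algebra_simps power2_eq_square)
    also have "c * (u' \<bullet> v) - bform A u' v = u' \<bullet> u'"
      by (simp add: u'_def bform_def inner_diff inner_commute algebra_simps)
    finally show ?thesis .
  qed
  have "u' \<bullet> u' = 0"
  proof (rule ccontr)
    define p where "p = u' \<bullet> u'"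
    define s where "s = c * p - bform A u' u'"
    assume "u' \<bullet> u' \<noteq> 0"
    then have p: "p > 0" by (simp add: p_def)
    \<comment> \<open>A step so short that the negative linear term outweighs the quadratic one.\<close>
    define a where "a = \<bar>s\<bar> + 1"
    define t where "t = - p / a"
    have a: "0 < a" "s \<le> a" by (auto simp: a_def)
    have "0 \<le> 2 * t * p + t\<^sup>2 * s" using quad[of t] by (simp add: p_def s_def)
    also have "\<dots> \<le> 2 * t * p + t\<^sup>2 * a"
      by (intro add_left_mono mult_left_mono a) auto
    also have "\<dots> = - (p * p / a)"
      unfolding t_def power2_eq_square using a by (simp add: field_simps)
    also have "\<dots> < 0" using p a by simp
    finally show False by simp
  qed
  then have "mat_of A *v v = c *\<^sub>R v" by (simp add: u'_def)
  with vv show ?thesis using that by blast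
qed

text \<open>
  Take an orthonormal set of eigenvectors of the largest possible size. Its orthogonal complement
  is invariant, since \<open>X\<close> is symmetric, and contains no further eigenvector, hence is zero.
\<close>

lemma eigenbasis_exists: "\<exists>lam e. eigenbasis (X :: ('n::finite) sym_mat) lam e"
proof -
  define P where "P B \<longleftrightarrow> pairwise orthogonal B \<and> (\<forall>v\<in>B. norm v = 1 \<and> (\<exists>c. mat_of X *v v = c *\<^sub>R v))"
    for B :: "(real^'n) set"
  have ind: "independent B" if "P B" for B
    using that by (intro pairwise_orthogonal_independent) (auto simp: P_def)
  have bound: "card B \<le> CARD('n)" if "P B" for B
    using independent_bound[OF ind[OF that]] by simp
  have "P {}" by (simp add: P_def)
  moreover have "\<forall>B. P B \<longrightarrow> card B < Suc CARD('n)" using bound by (simp add: less_Suc_eq_le)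
  ultimately have "\<exists>B. P B \<and> (\<forall>B'. P B' \<longrightarrow> card B' \<le> card B)"
    by (rule Lattices_Big.ex_has_greatest_nat)
  then obtain B where B: "P B" and Bmax: "\<forall>B'. P B' \<longrightarrow> card B' \<le> card B"
    by (elim exE conjE) (rule that)
  have fin: "finite B" using ind[OF B] by (rule independent_imp_finite)
  let ?S = "{y. \<forall>x\<in>B. orthogonal x y}"
  have "?S \<subseteq> {0}"
  proof
    fix u assume u: "u \<in> ?S"
    show "u \<in> {0}"
    proof (rule ccontr)
      assume "u \<notin> {0}"
      have inv: "mat_of X *v v \<in> ?S" if v: "v \<in> ?S" for v
      proof clarify
        fix x assume x: "x \<in> B"
        then obtain c where c: "mat_of X *v x = c *\<^sub>R x" using B by (auto simp: P_def)
        have "x \<bullet> (mat_of X *v v) = v \<bullet> (mat_of X *v x)"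
          using bform_commute[of X x v] by (simp add: bform_def)
        also have "\<dots> = 0" using v x by (simp add: c orthogonal_def inner_commute[of v x])
        finally show "orthogonal x (mat_of X *v v)" by (simp add: orthogonal_def)
      qed
      obtain v c where v: "v \<in> ?S" "norm v = 1" "mat_of X *v v = c *\<^sub>R v"
        using eigenvector_in_invariant_subspace[OF subspace_orthogonal_to_vectors inv u] \<open>u \<notin> {0}\<close>
        by blast
      have "v \<notin> B" using v by (auto simp: orthogonal_def)
      moreover have "P (insert v B)"
        using B v by (auto simp: P_def pairwise_insert orthogonal_commute)
      ultimately show False using Bmax[rule_format, of "insert v B"] fin by simp
    qed
  qed
  have "dim B = CARD('n)"
  proof (rule ccontr)
    assume "dim B \<noteq> CARD('n)"
    then have "dim B < DIM(real^'n)" using dim_subset_UNIV[of B] by simp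
    from orthogonal_to_subspace_exists[OF this]
    obtain x where "x \<noteq> 0" and x: "\<And>y. y \<in> span B \<Longrightarrow> orthogonal x y"
      by metis
    have "x \<in> ?S" using x by (auto simp: orthogonal_commute intro: span_base)
    with \<open>?S \<subseteq> {0}\<close> \<open>x \<noteq> 0\<close> show False by blast
  qed
  then have "card B = CARD('n)"
    using dim_eq_card_independent[OF ind[OF B]] by simp
  then obtain e where e: "bij_betw e (UNIV :: 'n set) B"
    using finite_same_card_bij[of "UNIV :: 'n set" B] fin by auto
  have eB: "e k \<in> B" for k using e by (auto simp: bij_betw_def)
  define lam where "lam k = (SOME c. mat_of X *v e k = c *\<^sub>R e k)" for k
  have lam: "mat_of X *v e k = lam k *\<^sub>R e k" for k
    unfolding lam_def using someI_ex[of "\<lambda>c. mat_of X *v e k = c *\<^sub>R e k"] B eB[of k]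
    by (auto simp: P_def)
  have "e i \<bullet> e j = (if i = j then 1 else 0)" for i j
  proof (cases "i = j")
    case True then show ?thesis using B eB[of j] by (auto simp: P_def norm_eq_1)
  next
    case False
    then have "e i \<noteq> e j" using e by (auto simp: bij_betw_def inj_on_def)
    then have "orthogonal (e i) (e j)" using B eB unfolding P_def pairwise_def by blast
    then show ?thesis using False by (simp add: orthogonal_def)
  qed
  then show ?thesis using lam unfolding eigenbasis_def by blast
qed

lemma eigenbasis_orthonormal: "eigenbasis X lam e \<Longrightarrow> orthonormal e"
  by (simp add: eigenbasis_def orthonormal_def)

section \<open>Coordinates in orthonormal bases\<close>

lemma orthonormal_parseval:
  assumes "orthonormal e"
  shows "x \<bullet> y = (\<Sum>k\<in>UNIV. (x \<bullet> e k) * (y \<bullet> e k))"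
proof -
  define P where "P = (\<chi> i j. e i $ j)"
  have row: "(P *v z) $ k = z \<bullet> e k" for z k
    by (simp add: P_def matrix_vector_mult_def inner_vec_def mult.commute)
  have "P ** transpose P = mat 1"
    using assms unfolding orthonormal_def
    by (simp add: vec_eq_iff matrix_matrix_mult_def transpose_def P_def mat_def inner_vec_def)
  then have "transpose P ** P = mat 1" by (simp add: matrix_left_right_inverse)
  then have "orthogonal_matrix P" by (simp add: orthogonal_matrix)
  then have "(P *v x) \<bullet> (P *v y) = x \<bullet> y"
    using orthogonal_transformation_matrix[of "(*v) P"]
    by (simp add: orthogonal_transformation_def)
  then show ?thesis by (simp add: inner_vec_def[of "P *v x"] row)
qed

lemma bform_parseval:
  assumes "orthonormal f"
  shows "bform A u v = (\<Sum>j\<in>UNIV. bform A u (f j) * (v \<bullet> f j))"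
proof -
  have left: "bform A u w = (mat_of A *v u) \<bullet> w" for w
    using bform_commute[of A u w] by (simp add: bform_def inner_commute)
  have "bform A u v = (mat_of A *v u) \<bullet> v" by (rule left)
  also have "\<dots> = (\<Sum>j\<in>UNIV. ((mat_of A *v u) \<bullet> f j) * (v \<bullet> f j))"
    by (rule orthonormal_parseval[OF assms])
  also have "\<dots> = (\<Sum>j\<in>UNIV. bform A u (f j) * (v \<bullet> f j))"
    by (simp add: left)
  finally show ?thesis .
qed

text \<open>
  The rows and columns may be expanded in two different bases. This freedom is what makes two
  matrices without a common eigenbasis comparable below.
\<close>

lemma inner_sym_mat_bform:
  fixes A B :: "('n::finite) sym_mat"
  assumes e: "orthonormal e" and f: "orthonormal f"
  shows "A \<bullet> B = (\<Sum>i\<in>UNIV. \<Sum>j\<in>UNIV. bform A (e i) (f j) * bform B (e i) (f j))"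
proof -
  let ?a = "mat_of A" and ?b = "mat_of B"
  have "A \<bullet> B = (\<Sum>i\<in>UNIV. ?a $ i \<bullet> ?b $ i)"
    by (simp add: inner_sym_mat.rep_eq inner_vec_def[of "mat_of A"])
  also have "\<dots> = (\<Sum>i\<in>UNIV. \<Sum>j\<in>UNIV. (?a $ i \<bullet> f j) * (?b $ i \<bullet> f j))"
    by (intro sum.cong refl orthonormal_parseval[OF f])
  also have "\<dots> = (\<Sum>j\<in>UNIV. (?a *v f j) \<bullet> (?b *v f j))"
    by (subst sum.swap) (simp add: inner_vec_def matrix_vector_mult_def)
  also have "\<dots> = (\<Sum>j\<in>UNIV. \<Sum>i\<in>UNIV. bform A (e i) (f j) * bform B (e i) (f j))"
    by (intro sum.cong refl, subst orthonormal_parseval[OF e]) (simp add: bform_def inner_commute)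
  also have "\<dots> = (\<Sum>i\<in>UNIV. \<Sum>j\<in>UNIV. bform A (e i) (f j) * bform B (e i) (f j))"
    by (rule sum.swap)
  finally show ?thesis .
qed

lemma norm_sym_mat_bform:
  fixes A :: "('n::finite) sym_mat"
  assumes e: "orthonormal e" and f: "orthonormal f"
  shows "(norm A)\<^sup>2 = (\<Sum>i\<in>UNIV. \<Sum>j\<in>UNIV. (bform A (e i) (f j))\<^sup>2)"
  unfolding power2_norm_eq_inner inner_sym_mat_bform[OF e f] by (simp add: power2_eq_square)

lemma sym_mat_eqI:
  fixes A B :: "('n::finite) sym_mat"
  assumes e: "orthonormal e" and f: "orthonormal f"
    and "\<And>i j. bform A (e i) (f j) = bform B (e i) (f j)"
  shows "A = B"
proof -
  have "(norm (A - B))\<^sup>2 = 0"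
    unfolding norm_sym_mat_bform[OF e f] by (simp add: bform_simps assms(3))
  then show ?thesis by simp
qed

lemma abs_bform_le_norm:
  fixes A :: "('n::finite) sym_mat"
  assumes e: "orthonormal e" and f: "orthonormal f"
  shows "\<bar>bform A (e i) (f j)\<bar> \<le> norm A"
proof -
  have "(bform A (e i) (f j))\<^sup>2 \<le> (\<Sum>j\<in>UNIV. (bform A (e i) (f j))\<^sup>2)"
    by (rule member_le_sum[of j UNIV "\<lambda>j. (bform A (e i) (f j))\<^sup>2"]) auto
  also have "\<dots> \<le> (norm A)\<^sup>2"
    unfolding norm_sym_mat_bform[OF e f]
    by (rule member_le_sum[of i UNIV "\<lambda>i. \<Sum>j\<in>UNIV. (bform A (e i) (f j))\<^sup>2"]) (auto intro: sum_nonneg)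
  finally show ?thesis by (simp add: abs_le_square_iff[symmetric])
qed

text \<open>
  The matrix \<open>\<Sum>\<^sub>k\<^sub>l w k l e\<^sub>k e\<^sub>l\<^sup>T\<close>. \<^const>\<open>Sym_mat\<close> is meaningful on symmetric arguments only, so the
  lemmas about it ask for a symmetric \<open>w\<close>.
\<close>

definition sym_mat_with :: "('n::finite \<Rightarrow> real^'n) \<Rightarrow> ('n \<Rightarrow> 'n \<Rightarrow> real) \<Rightarrow> 'n sym_mat"
  where "sym_mat_with e w = Sym_mat (\<chi> a b. \<Sum>k\<in>UNIV. \<Sum>l\<in>UNIV. w k l * e k $ a * e l $ b)"

lemma mat_of_sym_mat_with:
  assumes "\<And>k l. w k l = w l k"
  shows "mat_of (sym_mat_with e w) = (\<chi> a b. \<Sum>k\<in>UNIV. \<Sum>l\<in>UNIV. w k l * e k $ a * e l $ b)"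
  unfolding sym_mat_with_def
proof (rule Sym_mat_inverse, clarify)
  show "transpose (\<chi> a b. \<Sum>k\<in>UNIV. \<Sum>l\<in>UNIV. w k l * e k $ a * e l $ b)
      = (\<chi> a b. \<Sum>k\<in>UNIV. \<Sum>l\<in>UNIV. w k l * e k $ a * e l $ b)"
    unfolding transpose_def vec_eq_iff
  proof (intro allI)
    fix a b
    have "(\<Sum>k\<in>UNIV. \<Sum>l\<in>UNIV. w k l * e k $ b * e l $ a)
        = (\<Sum>l\<in>UNIV. \<Sum>k\<in>UNIV. w k l * e k $ b * e l $ a)"
      by (rule sum.swap)
    also have "\<dots> = (\<Sum>k\<in>UNIV. \<Sum>l\<in>UNIV. w k l * e k $ a * e l $ b)"
      by (intro sum.cong refl) (subst assms, simp only: mult_ac)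
    finally show "(\<chi> i j. (\<chi> a b. \<Sum>k\<in>UNIV. \<Sum>l\<in>UNIV. w k l * e k $ a * e l $ b) $ j $ i) $ a $ b
      = (\<chi> a b. \<Sum>k\<in>UNIV. \<Sum>l\<in>UNIV. w k l * e k $ a * e l $ b) $ a $ b"
      by simp
  qed
qed

lemma bform_sym_mat_with:
  fixes e :: "'n::finite \<Rightarrow> real^'n"
  assumes e: "orthonormal e" and w: "\<And>k l. w k l = w l k"
  shows "bform (sym_mat_with e w) (e i) (e j) = w i j"
proof -
  have mv: "(mat_of (sym_mat_with e w) *v v) = (\<Sum>k\<in>UNIV. \<Sum>l\<in>UNIV. (w k l * (e l \<bullet> v)) *\<^sub>R e k)" for v
  proof -
    have "(mat_of (sym_mat_with e w) *v v) $ a = (\<Sum>k\<in>UNIV. \<Sum>l\<in>UNIV. (w k l * (e l \<bullet> v)) *\<^sub>R e k) $ a" for a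
    proof -
      have "(mat_of (sym_mat_with e w) *v v) $ a
          = (\<Sum>b\<in>UNIV. \<Sum>k\<in>UNIV. \<Sum>l\<in>UNIV. w k l * e k $ a * e l $ b * v $ b)"
        by (simp add: mat_of_sym_mat_with[OF w] matrix_vector_mult_def sum_distrib_right)
      also have "\<dots> = (\<Sum>k\<in>UNIV. \<Sum>l\<in>UNIV. \<Sum>b\<in>UNIV. w k l * e k $ a * e l $ b * v $ b)"
        by (rule trans[OF sum.swap]) (intro sum.cong refl sum.swap)
      also have "\<dots> = (\<Sum>k\<in>UNIV. \<Sum>l\<in>UNIV. (w k l * (e l \<bullet> v)) *\<^sub>R e k) $ a"
        by (simp add: inner_vec_def sum_distrib_left sum_distrib_right mult_ac)
      finally show ?thesis .
    qed
    then show ?thesis by (simp add: vec_eq_iff)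
  qed
  have "mat_of (sym_mat_with e w) *v e j = (\<Sum>k\<in>UNIV. w k j *\<^sub>R e k)"
    using e unfolding mv orthonormal_def
    by (simp add: if_distrib[of "\<lambda>x. _ * x"] if_distrib[of "\<lambda>x. x *\<^sub>R _"] cong: if_cong)
  then show ?thesis
    using e unfolding bform_def orthonormal_def
    by (simp add: inner_sum_right if_distrib[of "\<lambda>x. _ * x"] cong: if_cong)
qed

section \<open>Functions of symmetric matrices\<close>

text \<open>
  Independence of the eigenbasis: for two eigenbases \<open>e\<close>, \<open>d\<close> of the same matrix,
  \<open>e\<^sub>i \<bullet> d\<^sub>j\<close> vanishes unless the eigenvalues of \<open>e\<^sub>i\<close> and \<open>d\<^sub>j\<close> agree, so the two candidates for
  \<open>f(X)\<close> have the same entries between \<open>e\<^sub>i\<close> and \<open>d\<^sub>j\<close>.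
\<close>

lemma spectral_fun_eq:
  fixes X :: "('n::finite) sym_mat"
  assumes X: "eigenbasis X lam e"
  shows "mat_of (spectral_fun f X) = (\<chi> i j. \<Sum>k\<in>UNIV. f (lam k) * e k $ i * e k $ j)"
proof -
  define W where "W l d = sym_mat_with d (\<lambda>i j. if i = j then f (l i) else 0)"
    for l :: "'n \<Rightarrow> real" and d :: "'n \<Rightarrow> real^'n"
  have W: "mat_of (W l d) = (\<chi> i j. \<Sum>k\<in>UNIV. f (l k) * d k $ i * d k $ j)" for l d
    unfolding W_def
    by (subst mat_of_sym_mat_with) (auto simp: vec_eq_iff if_distrib[of "\<lambda>x. x * _"] cong: if_cong)
  have Wv: "mat_of (W l d) *v v = (\<Sum>k\<in>UNIV. (f (l k) * (d k \<bullet> v)) *\<^sub>R d k)" for l d v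
  proof -
    have "(mat_of (W l d) *v v) $ a = (\<Sum>k\<in>UNIV. (f (l k) * (d k \<bullet> v)) *\<^sub>R d k) $ a" for a
    proof -
      have "(mat_of (W l d) *v v) $ a = (\<Sum>b\<in>UNIV. \<Sum>k\<in>UNIV. f (l k) * d k $ a * d k $ b * v $ b)"
        by (simp add: W matrix_vector_mult_def sum_distrib_right)
      also have "\<dots> = (\<Sum>k\<in>UNIV. \<Sum>b\<in>UNIV. f (l k) * d k $ a * d k $ b * v $ b)"
        by (rule sum.swap)
      also have "\<dots> = (\<Sum>k\<in>UNIV. (f (l k) * (d k \<bullet> v)) *\<^sub>R d k) $ a"
        by (simp add: inner_vec_def sum_distrib_left sum_distrib_right mult_ac)
      finally show ?thesis .
    qed
    then show ?thesis by (simp add: vec_eq_iff)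
  qed
  have We: "mat_of (W l d) *v d k = f (l k) *\<^sub>R d k" if "orthonormal d" for l d k
    using that unfolding Wv orthonormal_def
    by (simp add: if_distrib[of "\<lambda>x. _ * x"] if_distrib[of "\<lambda>x. x *\<^sub>R _"] cong: if_cong)
  have uniq: "W l d = W lam e" if d: "eigenbasis X l d" for l d
  proof (rule sym_mat_eqI[OF eigenbasis_orthonormal[OF X] eigenbasis_orthonormal[OF d]])
    fix i j
    note o = eigenbasis_orthonormal[OF X] eigenbasis_orthonormal[OF d]
    have "bform X (e i) (d j) = l j * (e i \<bullet> d j)"
      using d by (simp add: bform_def eigenbasis_def)
    moreover have "bform X (e i) (d j) = lam i * (e i \<bullet> d j)"
      using X by (subst bform_commute) (simp add: bform_def eigenbasis_def inner_commute)
    ultimately have "f (l j) * (e i \<bullet> d j) = f (lam i) * (e i \<bullet> d j)" by auto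
    moreover have "bform (W l d) (e i) (d j) = f (l j) * (e i \<bullet> d j)"
      by (simp add: bform_def We o)
    moreover have "bform (W lam e) (e i) (d j) = f (lam i) * (e i \<bullet> d j)"
      by (subst bform_commute) (simp add: bform_def We o inner_commute)
    ultimately show "bform (W l d) (e i) (d j) = bform (W lam e) (e i) (d j)" by simp
  qed
  have "spectral_fun f X = W lam e"
    unfolding spectral_fun_def
  proof (rule the_equality)
    show "\<exists>l d. eigenbasis X l d \<and> mat_of (W lam e) = (\<chi> i j. \<Sum>k\<in>UNIV. f (l k) * d k $ i * d k $ j)"
      using X W by blast
  next
    fix Y assume "\<exists>l d. eigenbasis X l d \<and> mat_of Y = (\<chi> i j. \<Sum>k\<in>UNIV. f (l k) * d k $ i * d k $ j)"
    then obtain l d where "eigenbasis X l d" "mat_of Y = mat_of (W l d)" by (auto simp: W)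
    then show "Y = W lam e" using uniq by (simp add: mat_of_inject)
  qed
  then show ?thesis by (simp add: W)
qed

lemma spectral_fun_eigenvector:
  fixes X :: "('n::finite) sym_mat"
  assumes X: "eigenbasis X lam e"
  shows "mat_of (spectral_fun f X) *v e k = f (lam k) *\<^sub>R e k"
proof -
  have "(mat_of (spectral_fun f X) *v e k) $ a = (f (lam k) *\<^sub>R e k) $ a" for a
  proof -
    have "(mat_of (spectral_fun f X) *v e k) $ a
        = (\<Sum>b\<in>UNIV. \<Sum>l\<in>UNIV. f (lam l) * e l $ a * e l $ b * e k $ b)"
      by (simp add: spectral_fun_eq[OF X] matrix_vector_mult_def sum_distrib_right)
    also have "\<dots> = (\<Sum>l\<in>UNIV. f (lam l) * e l $ a * (e l \<bullet> e k))"
      by (subst sum.swap) (simp add: inner_vec_def sum_distrib_left mult_ac)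
    also have "\<dots> = f (lam k) * e k $ a"
      using X by (simp add: eigenbasis_def if_distrib[of "\<lambda>x. _ * x"] cong: if_cong)
    finally show ?thesis by simp
  qed
  then show ?thesis by (simp add: vec_eq_iff)
qed

section \<open>Divided differences\<close>

text \<open>
  The first divided difference \<open>f[x, y]\<close>, continued to the diagonal by the derivative \<open>f'\<close>.
\<close>

definition ddiff :: "(real \<Rightarrow> real) \<Rightarrow> (real \<Rightarrow> real) \<Rightarrow> real \<Rightarrow> real \<Rightarrow> real"
  where "ddiff f f' x y = (if x = y then f' x else (f x - f y) / (x - y))"

lemma ddiff_mult: "ddiff f f' x y * (x - y) = f x - f y"
  by (simp add: ddiff_def)

lemma ddiff_commute: "ddiff f f' x y = ddiff f f' y x"
  by (simp add: ddiff_def) (metis minus_diff_eq minus_divide_divide)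

lemma ddiff_self [simp]: "ddiff f f' x x = f' x"
  by (simp add: ddiff_def)

lemma ddiff_mean_value:
  assumes "\<And>z. z \<in> {min x y..max x y} \<Longrightarrow> (f has_real_derivative f' z) (at z)"
  shows "\<exists>z\<in>{min x y..max x y}. ddiff f f' x y = f' z"
proof -
  have *: "\<exists>z\<in>{u..v}. ddiff f f' u v = f' z"
    if "u < v" and der: "\<And>z. z \<in> {u..v} \<Longrightarrow> (f has_real_derivative f' z) (at z)" for u v
  proof -
    obtain z where "u < z" "z < v" "f v - f u = (v - u) * f' z"
      using MVT2[of u v f f'] \<open>u < v\<close> der by auto
    then show ?thesis using \<open>u < v\<close>
      by (intro bexI[of _ z]) (auto simp: ddiff_def field_simps)
  qed
  consider "x < y" | "x = y" | "y < x" by linarith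
  then show ?thesis
  proof cases
    case 1 then show ?thesis using *[of x y] assms by simp
  next
    case 2 then show ?thesis by simp
  next
    case 3 then show ?thesis using *[of y x] assms by (simp add: ddiff_commute[of _ _ x y])
  qed
qed

text \<open>
  Since \<open>f[x, w]\<close> is the mean of \<open>f'\<close> over the segment from \<open>x\<close> to \<open>w\<close>, a Lipschitz constant of
  \<open>f'\<close> is inherited. The mean value theorem is used in place of the integral: the quotient along
  the segment, \<open>F w t\<close>, has derivative \<open>f' (x + t (w - x))\<close>.
\<close>

lemma ddiff_lipschitz:
  assumes der: "\<And>z. z \<in> {a..b} \<Longrightarrow> (f has_real_derivative f' z) (at z)"
    and lip: "\<And>y z. y \<in> {a..b} \<Longrightarrow> z \<in> {a..b} \<Longrightarrow> \<bar>f' y - f' z\<bar> \<le> K * \<bar>y - z\<bar>"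
    and x: "x \<in> {a..b}" and y: "y \<in> {a..b}" and z: "z \<in> {a..b}"
  shows "\<bar>ddiff f f' x y - ddiff f f' x z\<bar> \<le> K * \<bar>y - z\<bar>"
proof -
  define F where "F w t = (if w = x then t * f' x else (f (x + t * (w - x)) - f x) / (w - x))" for w t
  have mem: "x + t * (w - x) \<in> {a..b}" if "0 \<le> t" "t \<le> 1" "w \<in> {a..b}" for t w
  proof -
    have "x + t * (w - x) = (1 - t) * x + t * w" by (simp add: algebra_simps)
    then show ?thesis
      using convexD_alt[of "{a..b}" x w t] x that by simp
  qed
  have F: "(F w has_real_derivative f' (x + t * (w - x))) (at t)"
    if "0 \<le> t" "t \<le> 1" "w \<in> {a..b}" for w t
  proof (cases "w = x")
    case True then show ?thesis unfolding F_def by (auto intro!: derivative_eq_intros)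
  next
    case False
    have "((\<lambda>t. x + t * (w - x)) has_real_derivative w - x) (at t)"
      by (auto intro!: derivative_eq_intros)
    note chain = DERIV_chain2[where f = f and g = "\<lambda>t. x + t * (w - x)", OF der[OF mem[OF that]] this]
    have "((\<lambda>t. (f (x + t * (w - x)) - f x) / (w - x)) has_real_derivative
        (f' (x + t * (w - x)) * (w - x)) / (w - x)) (at t)"
      by (rule DERIV_cdivide) (rule derivative_eq_intros chain refl | simp)+
    with False show ?thesis unfolding F_def by simp
  qed
  have F0: "F w 0 = 0" for w by (simp add: F_def)
  have F1: "F w 1 = ddiff f f' x w" for w
    by (simp add: F_def ddiff_commute[of f f' x w]) (simp add: ddiff_def)
  have "\<exists>t>0. t < 1 \<and> (F y 1 - F z 1) - (F y 0 - F z 0)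
      = (1 - 0) * (f' (x + t * (y - x)) - f' (x + t * (z - x)))"
    by (rule MVT2) (auto intro!: DERIV_diff F y z)
  then obtain t where t: "0 < t" "t < 1"
    and "(F y 1 - F z 1) - (F y 0 - F z 0) = (1 - 0) * (f' (x + t * (y - x)) - f' (x + t * (z - x)))"
    by blast
  then have "\<bar>ddiff f f' x y - ddiff f f' x z\<bar> = \<bar>f' (x + t * (y - x)) - f' (x + t * (z - x))\<bar>"
    by (simp add: F0 F1)
  also have "\<dots> \<le> K * \<bar>(x + t * (y - x)) - (x + t * (z - x))\<bar>"
    using t y z by (intro lip mem) auto
  also have "(x + t * (y - x)) - (x + t * (z - x)) = t * (y - z)" by (simp add: algebra_simps)
  also have "K * \<bar>t * (y - z)\<bar> = t * (K * \<bar>y - z\<bar>)" using t by (simp add: abs_mult)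
  also have "\<dots> \<le> 1 * (K * \<bar>y - z\<bar>)"
    using t order_trans[OF abs_ge_zero lip[OF y z]] by (intro mult_right_mono) auto
  finally show ?thesis by simp
qed

section \<open>Exact increments and the derivative of a spectral function\<close>

lemma bform_spectral_fun_right:
  "eigenbasis X lam e \<Longrightarrow> bform (spectral_fun f X) v (e k) = f (lam k) * (v \<bullet> e k)"
  by (simp add: bform_def spectral_fun_eigenvector)

lemma bform_spectral_fun_left:
  "eigenbasis X lam e \<Longrightarrow> bform (spectral_fun f X) (e k) v = f (lam k) * (e k \<bullet> v)"
  by (subst bform_commute) (simp add: bform_spectral_fun_right inner_commute)

lemma bform_eigenvector_right: "eigenbasis X lam e \<Longrightarrow> bform X v (e k) = lam k * (v \<bullet> e k)"
  by (simp add: bform_def eigenbasis_def)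

lemma bform_eigenvector_left: "eigenbasis X lam e \<Longrightarrow> bform X (e k) v = lam k * (e k \<bullet> v)"
  by (subst bform_commute) (simp add: bform_eigenvector_right inner_commute)

lemma bform_eigenbasis:
  assumes X: "eigenbasis X lam e"
  shows "bform X u v = (\<Sum>k\<in>UNIV. lam k * (u \<bullet> e k) * (v \<bullet> e k))"
  by (simp add: bform_parseval[OF eigenbasis_orthonormal[OF X], of X u v] bform_eigenvector_right[OF X])

text \<open>
  The key identity. In the mixed basis that uses an eigenbasis of \<open>X\<close> on the left and one of \<open>Y\<close> on
  the right, the increment of a spectral function is the increment of the argument multiplied
  entrywise by divided differences. No remainder term occurs, however far apart \<open>X\<close> and \<open>Y\<close> are;
  Lipschitz bounds and monotonicity are read off from the size of the divided differences.
\<close>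

lemma bform_spectral_fun_diff:
  assumes X: "eigenbasis X lam e" and Y: "eigenbasis Y mu d"
  shows "bform (spectral_fun f X - spectral_fun f Y) (e i) (d j)
    = ddiff f f' (lam i) (mu j) * bform (X - Y) (e i) (d j)"
proof -
  have "bform (spectral_fun f X - spectral_fun f Y) (e i) (d j) = (f (lam i) - f (mu j)) * (e i \<bullet> d j)"
    by (simp add: bform_simps bform_spectral_fun_left[OF X] bform_spectral_fun_right[OF Y] algebra_simps)
  also have "\<dots> = ddiff f f' (lam i) (mu j) * ((lam i - mu j) * (e i \<bullet> d j))"
    by (simp add: ddiff_mult[of f f', symmetric])
  also have "(lam i - mu j) * (e i \<bullet> d j) = bform (X - Y) (e i) (d j)"
    by (simp add: bform_simps bform_eigenvector_left[OF X] bform_eigenvector_right[OF Y] algebra_simps)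
  finally show ?thesis .
qed

lemma norm_spectral_fun_diff_le:
  fixes X Y :: "('n::finite) sym_mat"
  assumes X: "eigenbasis X lam e" and Y: "eigenbasis Y mu d"
    and c: "\<And>i j. \<bar>ddiff f f' (lam i) (mu j)\<bar> \<le> c"
  shows "norm (spectral_fun f X - spectral_fun f Y) \<le> c * norm (X - Y)"
proof (rule power2_le_imp_le)
  note o = eigenbasis_orthonormal[OF X] eigenbasis_orthonormal[OF Y]
  have c0: "0 \<le> c" using order_trans[OF abs_ge_zero c] .
  show "0 \<le> c * norm (X - Y)" using c0 by simp
  have sq: "(ddiff f f' (lam i) (mu j))\<^sup>2 \<le> c\<^sup>2" for i j
    using c[of i j] c0 by (simp add: abs_le_square_iff[symmetric])
  show "(norm (spectral_fun f X - spectral_fun f Y))\<^sup>2 \<le> (c * norm (X - Y))\<^sup>2"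
    unfolding power_mult_distrib norm_sym_mat_bform[OF o] sum_distrib_left
      bform_spectral_fun_diff[OF X Y, of f _ _ f']
    by (intro sum_mono mult_right_mono sq) simp
qed

lemma inner_spectral_fun_diff_ge:
  fixes X Y :: "('n::finite) sym_mat"
  assumes X: "eigenbasis X lam e" and Y: "eigenbasis Y mu d"
    and c: "\<And>i j. c \<le> ddiff f f' (lam i) (mu j)"
  shows "c * (norm (X - Y))\<^sup>2 \<le> (spectral_fun f X - spectral_fun f Y) \<bullet> (X - Y)"
proof -
  note o = eigenbasis_orthonormal[OF X] eigenbasis_orthonormal[OF Y]
  have "c * (norm (X - Y))\<^sup>2 = (\<Sum>i\<in>UNIV. \<Sum>j\<in>UNIV. c * (bform (X - Y) (e i) (d j))\<^sup>2)"
    by (simp add: norm_sym_mat_bform[OF o] sum_distrib_left)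
  also have "\<dots> \<le> (\<Sum>i\<in>UNIV. \<Sum>j\<in>UNIV. ddiff f f' (lam i) (mu j) * (bform (X - Y) (e i) (d j))\<^sup>2)"
    by (intro sum_mono mult_right_mono c) simp
  also have "\<dots> = (spectral_fun f X - spectral_fun f Y) \<bullet> (X - Y)"
    unfolding inner_sym_mat_bform[OF o] bform_spectral_fun_diff[OF X Y, of f _ _ f']
    by (simp add: power2_eq_square mult.assoc)
  finally show ?thesis .
qed

text \<open>
  A coarse form of Weyl's inequality: an eigenvalue of \<open>Y\<close> is the value of its quadratic form at a
  unit vector, and there the forms of \<open>X\<close> and \<open>Y\<close> differ by at most the norm of \<open>Y - X\<close>.
\<close>

lemma eigenvalue_perturbation:
  fixes X Y :: "('n::finite) sym_mat"
  assumes X: "eigenbasis X lam e" and Y: "eigenbasis Y mu d" and lam: "\<And>k. lam k \<in> {l..L}"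
  shows "mu j \<in> {l - norm (Y - X)..L + norm (Y - X)}"
proof -
  note o = eigenbasis_orthonormal[OF X] eigenbasis_orthonormal[OF Y]
  have dj: "d j \<bullet> d j = 1" using Y by (simp add: eigenbasis_def)
  have one: "(\<Sum>k\<in>UNIV. (d j \<bullet> e k) * (d j \<bullet> e k)) = 1"
    using orthonormal_parseval[OF o(1), of "d j" "d j"] dj by simp
  have "(\<Sum>k\<in>UNIV. l * ((d j \<bullet> e k) * (d j \<bullet> e k))) \<le> bform X (d j) (d j)"
    unfolding bform_eigenbasis[OF X] mult.assoc
    using lam by (intro sum_mono mult_right_mono) auto
  moreover have "bform X (d j) (d j) \<le> (\<Sum>k\<in>UNIV. L * ((d j \<bullet> e k) * (d j \<bullet> e k)))"
    unfolding bform_eigenbasis[OF X] mult.assoc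
    using lam by (intro sum_mono mult_right_mono) auto
  moreover have "mu j = bform X (d j) (d j) + bform (Y - X) (d j) (d j)"
    by (simp add: bform_simps bform_eigenvector_right[OF Y] dj)
  moreover have "\<bar>bform (Y - X) (d j) (d j)\<bar> \<le> norm (Y - X)"
    by (rule abs_bform_le_norm[OF o(2) o(2)])
  ultimately show ?thesis
    unfolding sum_distrib_left[symmetric] one by auto
qed

text \<open>
  The Daleckii-Krein formula: Schur multiplication by divided differences in an eigenbasis.
\<close>

definition spectral_deriv ::
  "(real \<Rightarrow> real) \<Rightarrow> (real \<Rightarrow> real) \<Rightarrow> ('n::finite \<Rightarrow> real) \<Rightarrow> ('n \<Rightarrow> real^'n) \<Rightarrow> 'n sym_mat \<Rightarrow> 'n sym_mat"
  where "spectral_deriv f f' lam e D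
    = sym_mat_with e (\<lambda>i j. ddiff f f' (lam i) (lam j) * bform D (e i) (e j))"

lemma bform_spectral_deriv:
  assumes "orthonormal e"
  shows "bform (spectral_deriv f f' lam e D) (e i) (e j)
    = ddiff f f' (lam i) (lam j) * bform D (e i) (e j)"
  unfolding spectral_deriv_def
  by (rule bform_sym_mat_with[OF assms]) (metis bform_commute ddiff_commute)

text \<open>
  The exact increment has the multiplier \<open>f[\<lambda>\<^sub>i, \<mu>\<^sub>j]\<close> where the derivative has \<open>f[\<lambda>\<^sub>i, \<lambda>\<^sub>k]\<close>. The
  eigenvectors of \<open>Y\<close> need not be close to those of \<open>X\<close>, but the overlap of \<open>e\<^sub>k\<close> and \<open>d\<^sub>j\<close> always
  compensates: \<open>f[\<lambda>\<^sub>i, \<mu>\<^sub>j] - f[\<lambda>\<^sub>i, \<lambda>\<^sub>k]\<close> is of the order of \<open>\<mu>\<^sub>j - \<lambda>\<^sub>k\<close>, and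
  \<open>(\<mu>\<^sub>j - \<lambda>\<^sub>k) (e\<^sub>k \<bullet> d\<^sub>j)\<close> is an entry of \<open>Y - X\<close>. So every entry of the error is quadratic in
  \<open>Y - X\<close>, and no case distinction for multiple eigenvalues is needed.
\<close>

theorem spectral_fun_has_derivative:
  fixes X :: "('n::finite) sym_mat"
  assumes X: "eigenbasis X lam e" and lam: "\<And>k. lam k \<in> {a<..<b}"
    and der: "\<And>z. z \<in> {a..b} \<Longrightarrow> (f has_real_derivative f' z) (at z)"
    and lip: "\<And>y z. y \<in> {a..b} \<Longrightarrow> z \<in> {a..b} \<Longrightarrow> \<bar>f' y - f' z\<bar> \<le> K * \<bar>y - z\<bar>"
  shows "(spectral_fun f has_derivative spectral_deriv f f' lam e) (at X)"
  unfolding has_derivative_at_alt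
proof (intro conjI allI impI)
  note oe = eigenbasis_orthonormal[OF X]
  let ?M = "spectral_deriv f f' lam e"
  have "linear ?M"
    by (intro linearI sym_mat_eqI[OF oe oe])
      (simp_all add: bform_spectral_deriv[OF oe] bform_simps algebra_simps)
  then show "bounded_linear ?M" by (simp add: linear_conv_bounded_linear)
  fix \<epsilon> :: real assume "0 < \<epsilon>"
  define l where "l = Min (range lam)"
  define L where "L = Max (range lam)"
  have lL: "lam k \<in> {l..L}" for k by (auto simp: l_def L_def)
  have "l \<in> range lam" "L \<in> range lam" unfolding l_def L_def by (auto intro!: Min_in Max_in)
  then have ab: "a < l" "L < b" using lam by auto
  define n where "n = real CARD('n)"
  have n: "0 < n" by (simp add: n_def)
  \<comment> \<open>The error is at most \<open>n\<^sup>2 K\<close> times the squared norm of \<open>Y - X\<close>; adding \<open>1\<close> keeps \<open>N\<close> positive.\<close>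
  define N where "N = n * n * \<bar>K\<bar> + 1"
  have N: "0 < N" using n by (simp add: N_def add_nonneg_pos)
  define \<delta> where "\<delta> = min (min (l - a) (b - L)) (\<epsilon> / N)"
  have \<delta>: "0 < \<delta>" using ab \<open>0 < \<epsilon>\<close> N by (simp add: \<delta>_def)
  have "norm (spectral_fun f Y - spectral_fun f X - ?M (Y - X)) \<le> \<epsilon> * norm (Y - X)"
    if Y\<delta>: "norm (Y - X) < \<delta>" for Y
  proof -
    obtain mu d where Y: "eigenbasis Y mu d" using eigenbasis_exists by blast
    note od = eigenbasis_orthonormal[OF Y]
    let ?D = "Y - X" and ?g = "ddiff f f'"
    have lamab: "lam k \<in> {a..b}" for k using lam[of k] by simp
    have muab: "mu j \<in> {a..b}" for j
      using eigenvalue_perturbation[OF X Y lL, of j] Y\<delta> by (auto simp: \<delta>_def)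
    let ?E = "spectral_fun f Y - spectral_fun f X - ?M ?D"
    have entry: "\<bar>bform ?E (e i) (e k)\<bar> \<le> n * (\<bar>K\<bar> * (norm ?D)\<^sup>2)" for i k
    proof -
      have "bform (spectral_fun f Y - spectral_fun f X) (e i) (d j) = ?g (lam i) (mu j) * bform ?D (e i) (d j)" for j
        using bform_spectral_fun_diff[OF X Y, of f i j f'] by (simp add: bform_simps algebra_simps)
      then have "bform (spectral_fun f Y - spectral_fun f X) (e i) (e k)
          = (\<Sum>j\<in>UNIV. ?g (lam i) (mu j) * bform ?D (e i) (d j) * (e k \<bullet> d j))"
        using bform_parseval[OF od, of "spectral_fun f Y - spectral_fun f X" "e i" "e k"] by simp
      moreover have "bform (?M ?D) (e i) (e k)
          = (\<Sum>j\<in>UNIV. ?g (lam i) (lam k) * bform ?D (e i) (d j) * (e k \<bullet> d j))"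
        unfolding bform_spectral_deriv[OF oe] bform_parseval[OF od, of ?D "e i" "e k"] sum_distrib_left
        by (simp add: mult.assoc)
      ultimately have eq: "bform ?E (e i) (e k) = (\<Sum>j\<in>UNIV. (?g (lam i) (mu j) - ?g (lam i) (lam k))
          * bform ?D (e i) (d j) * (e k \<bullet> d j))"
        unfolding bform_minus[of "spectral_fun f Y - spectral_fun f X" "?M ?D"]
        by (simp only: sum_subtractf[symmetric] left_diff_distrib)
      have "\<bar>bform ?E (e i) (e k)\<bar> \<le> (\<Sum>j\<in>(UNIV::'n set). \<bar>K\<bar> * (norm ?D)\<^sup>2)"
        unfolding eq
      proof (rule order_trans[OF sum_abs], rule sum_mono)
        fix j
        have "\<bar>?g (lam i) (mu j) - ?g (lam i) (lam k)\<bar> \<le> K * \<bar>mu j - lam k\<bar>"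
          by (rule ddiff_lipschitz[OF der lip lamab muab lamab])
        also have "\<dots> \<le> \<bar>K\<bar> * \<bar>mu j - lam k\<bar>" by (intro mult_right_mono) auto
        finally have "\<bar>?g (lam i) (mu j) - ?g (lam i) (lam k)\<bar> * \<bar>bform ?D (e i) (d j)\<bar> * \<bar>e k \<bullet> d j\<bar>
            \<le> (\<bar>K\<bar> * \<bar>mu j - lam k\<bar>) * norm ?D * \<bar>e k \<bullet> d j\<bar>"
          by (intro mult_mono abs_bform_le_norm[OF oe od]) auto
        also have "\<dots> = \<bar>K\<bar> * norm ?D * \<bar>(mu j - lam k) * (e k \<bullet> d j)\<bar>" by (simp add: abs_mult)
        also have "(mu j - lam k) * (e k \<bullet> d j) = bform ?D (e k) (d j)"
          by (simp add: bform_simps bform_eigenvector_left[OF X] bform_eigenvector_right[OF Y] algebra_simps)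
        also have "\<bar>K\<bar> * norm ?D * \<bar>bform ?D (e k) (d j)\<bar> \<le> \<bar>K\<bar> * norm ?D * norm ?D"
          by (intro mult_left_mono abs_bform_le_norm[OF oe od]) auto
        finally show "\<bar>(?g (lam i) (mu j) - ?g (lam i) (lam k)) * bform ?D (e i) (d j) * (e k \<bullet> d j)\<bar>
            \<le> \<bar>K\<bar> * (norm ?D)\<^sup>2" by (simp add: abs_mult power2_eq_square mult.assoc)
      qed
      then show ?thesis by (simp add: n_def)
    qed
    have "norm ?E \<le> n * (n * (\<bar>K\<bar> * (norm ?D)\<^sup>2))"
    proof (rule power2_le_imp_le)
      have "(norm ?E)\<^sup>2 = (\<Sum>i\<in>UNIV. \<Sum>k\<in>UNIV. (bform ?E (e i) (e k))\<^sup>2)"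
        by (rule norm_sym_mat_bform[OF oe oe])
      also have "\<dots> \<le> (\<Sum>i\<in>(UNIV::'n set). \<Sum>k\<in>(UNIV::'n set). (n * (\<bar>K\<bar> * (norm ?D)\<^sup>2))\<^sup>2)"
      proof (intro sum_mono)
        fix i k
        show "(bform ?E (e i) (e k))\<^sup>2 \<le> (n * (\<bar>K\<bar> * (norm ?D)\<^sup>2))\<^sup>2"
          using entry[of i k] n by (simp add: abs_le_square_iff[symmetric])
      qed
      also have "\<dots> = (n * (n * (\<bar>K\<bar> * (norm ?D)\<^sup>2)))\<^sup>2"
        by (simp add: n_def power2_eq_square)
      finally show "(norm ?E)\<^sup>2 \<le> (n * (n * (\<bar>K\<bar> * (norm ?D)\<^sup>2)))\<^sup>2" .
      show "0 \<le> n * (n * (\<bar>K\<bar> * (norm ?D)\<^sup>2))" using n by simp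
    qed
    also have "\<dots> \<le> (N * norm ?D) * norm ?D"
      by (simp add: N_def power2_eq_square algebra_simps)
    also have "\<dots> \<le> \<epsilon> * norm ?D"
      using Y\<delta> N by (intro mult_right_mono) (auto simp: \<delta>_def field_simps)
    finally show ?thesis .
  qed
  then show "\<exists>\<delta>>0. \<forall>Y. norm (Y - X) < \<delta> \<longrightarrow>
      norm (spectral_fun f Y - spectral_fun f X - ?M (Y - X)) \<le> \<epsilon> * norm (Y - X)"
    using \<delta> by blast
qed

lemma trace_eq_inner_identity: "trace (mat_of A) = Sym_mat (mat 1) \<bullet> A"
  by (simp add: inner_sym_mat_trace Sym_mat_inverse transpose_mat)

lemma trace_bform:
  assumes e: "orthonormal e"
  shows "trace (mat_of A) = (\<Sum>k\<in>UNIV. bform A (e k) (e k))"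
proof -
  have "bform (Sym_mat (mat 1)) (e i) (e j) = (if i = j then 1 else 0)" for i j
    using e by (simp add: bform_def Sym_mat_inverse transpose_mat orthonormal_def)
  then show ?thesis
    by (simp add: trace_eq_inner_identity inner_sym_mat_bform[OF e e]
        if_distrib[of "\<lambda>x. x * _"] cong: if_cong)
qed

lemma trace_spectral_fun:
  assumes "eigenbasis X lam e"
  shows "trace (mat_of (spectral_fun f X)) = (\<Sum>k\<in>UNIV. f (lam k))"
  using assms unfolding trace_bform[OF eigenbasis_orthonormal[OF assms]]
  by (simp add: bform_spectral_fun_right) (simp add: eigenbasis_def)

text \<open>
  Only the diagonal divided differences, that is, the values of \<open>f'\<close>, contribute to the trace of
  the derivative.
\<close>

lemma trace_spectral_fun_gradient:
  fixes X :: "('n::finite) sym_mat"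
  assumes X: "eigenbasis X lam e" and D: "(spectral_fun f has_derivative spectral_deriv f f' lam e) (at X)"
  shows "GDERIV (\<lambda>Y. trace (mat_of (spectral_fun f Y))) X :> spectral_fun f' X"
proof -
  note oe = eigenbasis_orthonormal[OF X]
  have "Sym_mat (mat 1) \<bullet> spectral_deriv f f' lam e h = h \<bullet> spectral_fun f' X" for h
  proof -
    have "Sym_mat (mat 1) \<bullet> spectral_deriv f f' lam e h = (\<Sum>k\<in>UNIV. f' (lam k) * bform h (e k) (e k))"
      by (simp add: trace_eq_inner_identity[symmetric] trace_bform[OF oe] bform_spectral_deriv[OF oe])
    also have "\<dots> = h \<bullet> spectral_fun f' X"
      using oe unfolding inner_sym_mat_bform[OF oe oe] bform_spectral_fun_right[OF X] orthonormal_def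
      by (simp add: if_distrib[of "\<lambda>x. _ * x"] mult.commute cong: if_cong)
    finally show ?thesis .
  qed
  then show ?thesis
    using bounded_linear.has_derivative[OF bounded_linear_inner_right D, of "Sym_mat (mat 1)"]
    by (simp add: gderiv_def trace_eq_inner_identity)
qed

section \<open>Eigenvalues and positive definiteness\<close>

lemma eigenbasis_nontrivial_component:
  assumes X: "eigenbasis X lam e" and v: "v \<noteq> 0"
  shows "\<exists>k. v \<bullet> e k \<noteq> 0"
proof (rule ccontr)
  assume "\<nexists>k. v \<bullet> e k \<noteq> 0"
  then have "v \<bullet> v = 0"
    using orthonormal_parseval[OF eigenbasis_orthonormal[OF X], of v v] by simp
  with v show False by simp
qed

lemma eigenvalues_eq_range:
  assumes X: "eigenbasis X lam e"
  shows "eigenvalues X = range lam"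
proof (intro equalityI subsetI)
  fix l assume "l \<in> eigenvalues X"
  then obtain v where v: "v \<noteq> 0" "mat_of X *v v = l *\<^sub>R v" by (auto simp: eigenvalues_def)
  obtain k where k: "v \<bullet> e k \<noteq> 0" using eigenbasis_nontrivial_component[OF X v(1)] by blast
  have "lam k * (e k \<bullet> v) = bform X (e k) v" by (simp add: bform_eigenvector_left[OF X])
  also have "\<dots> = l * (e k \<bullet> v)" by (simp add: bform_def v(2))
  finally have "lam k = l" using k by (simp add: inner_commute)
  then show "l \<in> range lam" by blast
next
  fix l assume "l \<in> range lam"
  then obtain k where "l = lam k" by blast
  moreover have "e k \<noteq> 0" using X by (auto simp: eigenbasis_def dest!: spec[of _ k])
  ultimately show "l \<in> eigenvalues X" using X by (auto simp: eigenbasis_def eigenvalues_def)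
qed

lemma pos_def_iff_eigenvalues_pos:
  assumes X: "eigenbasis X lam e"
  shows "pos_def X \<longleftrightarrow> (\<forall>k. 0 < lam k)"
proof
  assume pd: "pos_def X"
  show "\<forall>k. 0 < lam k"
  proof
    fix k
    have ek: "e k \<bullet> e k = 1" using X by (simp add: eigenbasis_def)
    then have "e k \<noteq> 0" by auto
    with pd have "0 < bform X (e k) (e k)" by (simp add: pos_def_def bform_def)
    then show "0 < lam k" by (simp add: bform_eigenvector_right[OF X] ek)
  qed
next
  assume lam: "\<forall>k. 0 < lam k"
  show "pos_def X"
    unfolding pos_def_def
  proof (intro allI impI)
    fix v :: "real^'a" assume "v \<noteq> 0"
    then obtain k where k: "v \<bullet> e k \<noteq> 0" using eigenbasis_nontrivial_component[OF X] by blast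
    have "0 < lam k * (v \<bullet> e k) * (v \<bullet> e k)" using lam k by (auto simp: mult.assoc zero_less_mult_iff linorder_neq_iff)
    then have "0 < (\<Sum>k\<in>UNIV. lam k * (v \<bullet> e k) * (v \<bullet> e k))"
      using lam by (intro sum_pos2[of UNIV k]) (auto simp: mult.assoc less_imp_le)
    then show "0 < v \<bullet> (mat_of X *v v)"
      by (simp add: bform_eigenbasis[OF X, symmetric] bform_def)
  qed
qed

lemma det_eigenbasis:
  fixes X :: "('n::finite) sym_mat"
  assumes X: "eigenbasis X lam e"
  shows "det (mat_of X) = (\<Prod>k\<in>UNIV. lam k)"
proof -
  define P where "P = (\<chi> i j. e j $ i)"
  define D where "D = (\<chi> i j. if i = j then lam j else (0::real))"
  have "transpose P ** P = mat 1"
    using X unfolding eigenbasis_def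
    by (simp add: vec_eq_iff matrix_matrix_mult_def transpose_def P_def mat_def inner_vec_def)
  then have "det P * det P = 1"
    by (metis det_I det_mul det_transpose)
  then have P: "det P \<noteq> 0" by auto
  have "mat_of X ** P = P ** D"
  proof -
    have "(mat_of X ** P) $ i $ j = (mat_of X *v e j) $ i" for i j
      by (simp add: matrix_matrix_mult_def matrix_vector_mult_def P_def)
    moreover have "(P ** D) $ i $ j = (lam j *\<^sub>R e j) $ i" for i j
      by (simp add: matrix_matrix_mult_def P_def D_def if_distrib[of "\<lambda>x. _ * x"] cong: if_cong)
    ultimately show ?thesis using X by (simp add: vec_eq_iff eigenbasis_def)
  qed
  then have "det (mat_of X) * det P = det P * det D" by (metis det_mul)
  moreover have "det D = (\<Prod>k\<in>UNIV. lam k)"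
    by (subst det_diagonal) (simp_all add: D_def)
  ultimately show ?thesis using P by simp
qed

lemma eigenvalue_bounds:
  assumes X: "eigenbasis X lam e"
  shows "lam k \<in> {lambda_min X..lambda_max X}"
  by (simp add: lambda_min_def lambda_max_def eigenvalues_eq_range[OF X])

lemma lambda_pos:
  assumes "pos_def X"
  shows "0 < lambda_min X" "lambda_min X \<le> lambda_max X"
proof -
  obtain lam e where X: "eigenbasis X lam e" using eigenbasis_exists by blast
  have "lambda_min X \<in> range lam"
    unfolding lambda_min_def eigenvalues_eq_range[OF X] by (rule Min_in) auto
  then show "0 < lambda_min X" using assms by (auto simp: pos_def_iff_eigenvalues_pos[OF X])
  show "lambda_min X \<le> lambda_max X"
    using eigenvalue_bounds[OF X] by (meson atLeastAtMost_iff order_trans)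
qed

lemma eigenvalues_near:
  assumes X: "pos_def X" and Y: "eigenbasis Y mu d" and r: "norm (Y - X) \<le> r"
  shows "mu j \<in> {lambda_min X - r..lambda_max X + r}"
proof -
  obtain lam e where E: "eigenbasis X lam e" using eigenbasis_exists by blast
  show ?thesis
    using eigenvalue_perturbation[OF E Y eigenvalue_bounds[OF E], of j] r by auto
qed

lemma pos_def_near:
  assumes X: "pos_def X" and Y: "norm (Y - X) < lambda_min X"
  shows "pos_def Y"
proof -
  obtain mu d where E: "eigenbasis Y mu d" using eigenbasis_exists by blast
  have "0 < mu j" for j using eigenvalues_near[OF X E order_refl, of j] Y by simp
  then show ?thesis by (simp add: pos_def_iff_eigenvalues_pos[OF E])
qed

lemma open_pos_def: "open {X. pos_def X}"
  unfolding open_dist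
proof clarify
  fix X :: "'a sym_mat" assume "pos_def X"
  then show "\<exists>e>0. \<forall>Y. dist Y X < e \<longrightarrow> Y \<in> {X. pos_def X}"
    using lambda_pos(1) pos_def_near by (intro exI[of _ "lambda_min X"]) (auto simp: dist_norm)
qed

lemma spectral_fun_has_derivative_pos_def:
  fixes X :: "('n::finite) sym_mat"
  assumes X: "eigenbasis X lam e" and pd: "pos_def X"
    and der: "\<And>x. 0 < x \<Longrightarrow> (f has_real_derivative f' x) (at x)"
    and der': "\<And>x. 0 < x \<Longrightarrow> (f' has_real_derivative f'' x) (at x)"
    and cont: "continuous_on {0<..} f''"
  shows "(spectral_fun f has_derivative spectral_deriv f f' lam e) (at X)"
proof -
  define a where "a = lambda_min X / 2"
  define b where "b = lambda_max X + 1"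
  have pos: "0 < a" using lambda_pos[OF pd] by (simp add: a_def)
  have "compact (f'' ` {a..b})"
    using pos by (intro compact_continuous_image continuous_on_subset[OF cont]) auto
  then have "\<exists>K. \<forall>z\<in>{a..b}. \<bar>f'' z\<bar> \<le> K"
    by (auto dest!: compact_imp_bounded simp: bounded_iff)
  then obtain K where K: "\<And>z. z \<in> {a..b} \<Longrightarrow> \<bar>f'' z\<bar> \<le> K" by blast
  show ?thesis
  proof (rule spectral_fun_has_derivative[OF X, of a b f f' K])
    show "lam k \<in> {a<..<b}" for k
      using eigenvalue_bounds[OF X, of k] lambda_pos[OF pd] by (auto simp: a_def b_def)
    show "(f has_real_derivative f' z) (at z)" if "z \<in> {a..b}" for z
      using der that pos by simp
    show "\<bar>f' y - f' z\<bar> \<le> K * \<bar>y - z\<bar>" if "y \<in> {a..b}" "z \<in> {a..b}" for y z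
      using field_differentiable_bound[of "{a..b}" f' f'' K y z] der' pos K that
      by (force intro: has_field_derivative_at_within)
  qed
qed

section \<open>Gradient and Hessian of the barrier\<close>

text \<open>
  The scalar functions behind the barrier: the barrier is \<open>tr \<psi>(X)\<close> with \<open>\<psi>\<close> the function
  \<open>barrier_scalar\<close>, and \<open>barrier_slope\<close> and \<open>barrier_curv\<close> are \<open>\<psi>'\<close> and \<open>\<psi>''\<close>.
\<close>

definition barrier_scalar :: "real \<Rightarrow> real \<Rightarrow> real \<Rightarrow> real"
  where "barrier_scalar q \<eta> x = - ln x + \<eta> / (q - 1) * (x powr (- (q - 1)) - 1)"

definition barrier_slope :: "real \<Rightarrow> real \<Rightarrow> real \<Rightarrow> real"
  where "barrier_slope q \<eta> x = - (1 / x) - \<eta> * x powr (- q)"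

definition barrier_curv :: "real \<Rightarrow> real \<Rightarrow> real \<Rightarrow> real"
  where "barrier_curv q \<eta> x = x powr (- 2) + \<eta> * q * x powr (- q - 1)"

lemma barrier_eq_trace:
  fixes X :: "('n::finite) sym_mat"
  assumes "pos_def X"
  shows "barrier q \<eta> X = trace (mat_of (spectral_fun (barrier_scalar q \<eta>) X))"
proof -
  obtain lam e where X: "eigenbasis X lam e" using eigenbasis_exists by blast
  have "ln (det (mat_of X)) = (\<Sum>k\<in>UNIV. ln (lam k))"
    unfolding det_eigenbasis[OF X] using assms pos_def_iff_eigenvalues_pos[OF X]
    by (intro ln_prod) (auto simp: less_imp_neq[symmetric])
  then show ?thesis
    unfolding barrier_def sym_powr_def trace_spectral_fun[OF X]
    by (simp add: barrier_scalar_def sum.distrib sum_negf sum_subtractf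
        flip: sum_distrib_left sum_divide_distrib)
qed

lemma barrier_scalar_deriv:
  assumes "1 < q" "0 < x"
  shows "(barrier_scalar q \<eta> has_real_derivative barrier_slope q \<eta> x) (at x)"
proof -
  have "((\<lambda>x. - ln x + \<eta> / (q - 1) * (x powr (- (q - 1)) - 1)) has_real_derivative
      - (1 / x) + \<eta> / (q - 1) * (- (q - 1) * x powr (- (q - 1) - 1) - 0)) (at x)"
    using assms
    by (intro DERIV_add DERIV_minus DERIV_cmult DERIV_diff DERIV_const DERIV_ln_divide
        has_real_derivative_powr)
  also have "- (1 / x) + \<eta> / (q - 1) * (- (q - 1) * x powr (- (q - 1) - 1) - 0) = barrier_slope q \<eta> x"
  proof -
    have "\<eta> / (q - 1) * (- (q - 1) * p - 0) = - \<eta> * p" for p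
      using assms by (simp add: field_simps)
    then show ?thesis by (simp only: barrier_slope_def) simp
  qed
  finally show ?thesis by (simp add: barrier_scalar_def[abs_def])
qed

lemma barrier_slope_deriv:
  assumes "0 < x"
  shows "(barrier_slope q \<eta> has_real_derivative barrier_curv q \<eta> x) (at x)"
proof -
  have "((\<lambda>x. 1 / x) has_real_derivative - (1 / x\<^sup>2)) (at x)"
    using assms by (auto intro!: derivative_eq_intros simp: power2_eq_square)
  then have "((\<lambda>x. - (1 / x) - \<eta> * x powr (- q)) has_real_derivative
      - (- (1 / x\<^sup>2)) - \<eta> * (- q * x powr (- q - 1))) (at x)"
    using assms by (intro DERIV_minus DERIV_cmult DERIV_diff has_real_derivative_powr)
  also have "- (- (1 / x\<^sup>2)) - \<eta> * (- q * x powr (- q - 1)) = barrier_curv q \<eta> x"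
    using assms by (simp add: barrier_curv_def powr_minus powr_numeral divide_inverse)
  finally show ?thesis by (simp add: barrier_slope_def[abs_def])
qed

lemma barrier_curv_deriv:
  assumes "0 < x"
  shows "(barrier_curv q \<eta> has_real_derivative
    - 2 * x powr (- 2 - 1) + \<eta> * q * ((- q - 1) * x powr (- q - 1 - 1))) (at x)"
  unfolding barrier_curv_def
  using assms by (auto intro!: derivative_eq_intros has_real_derivative_powr')

lemma gradient_unique:
  assumes "GDERIV f x :> D"
  shows "gradient f x = D"
  unfolding gradient_def
proof (rule the_equality)
  show "GDERIV f x :> D" by (rule assms)
  fix D' assume "GDERIV f x :> D'"
  then have "(\<lambda>h. h \<bullet> D') = (\<lambda>h. h \<bullet> D)"
    using assms has_derivative_unique unfolding gderiv_def by blast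
  then show "D' = D" by (metis vector_eq_ldot)
qed

text \<open>
  The barrier agrees with a spectral trace function throughout the open cone of positive definite
  matrices, which suffices for its derivative there.
\<close>

lemma gradient_barrier:
  fixes X :: "('n::finite) sym_mat"
  assumes q: "1 < q" and pd: "pos_def X"
  shows "gradient (barrier q \<eta>) X = spectral_fun (barrier_slope q \<eta>) X"
proof (rule gradient_unique)
  obtain lam e where X: "eigenbasis X lam e" using eigenbasis_exists by blast
  have "(spectral_fun (barrier_scalar q \<eta>) has_derivative
      spectral_deriv (barrier_scalar q \<eta>) (barrier_slope q \<eta>) lam e) (at X)"
  proof (rule spectral_fun_has_derivative_pos_def[OF X pd barrier_scalar_deriv[OF q] barrier_slope_deriv])
    show "continuous_on {0<..} (barrier_curv q \<eta>)"
      by (intro continuous_at_imp_continuous_on ballI DERIV_isCont[OF barrier_curv_deriv]) simp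
  qed
  from trace_spectral_fun_gradient[OF X this]
  show "GDERIV (barrier q \<eta>) X :> spectral_fun (barrier_slope q \<eta>) X"
    unfolding gderiv_def
    by (rule has_derivative_transform_within_open[OF _ open_pos_def])
      (simp_all add: pd barrier_eq_trace)
qed

lemma hessian_barrier:
  fixes X :: "('n::finite) sym_mat"
  assumes q: "1 < q" and pd: "pos_def X" and X: "eigenbasis X lam e"
  shows "hessian (barrier q \<eta>) X = spectral_deriv (barrier_slope q \<eta>) (barrier_curv q \<eta>) lam e"
proof -
  have "(spectral_fun (barrier_slope q \<eta>) has_derivative
      spectral_deriv (barrier_slope q \<eta>) (barrier_curv q \<eta>) lam e) (at X)"
  proof (rule spectral_fun_has_derivative_pos_def[OF X pd barrier_slope_deriv barrier_curv_deriv])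
    show "continuous_on {0<..} (\<lambda>x. - 2 * x powr (- 2 - 1) + \<eta> * q * ((- q - 1) * x powr (- q - 1 - 1)))"
      by (intro continuous_intros) auto
  qed
  then have "(gradient (barrier q \<eta>) has_derivative
      spectral_deriv (barrier_slope q \<eta>) (barrier_curv q \<eta>) lam e) (at X)"
    by (rule has_derivative_transform_within_open[OF _ open_pos_def])
      (simp_all add: pd gradient_barrier[OF q])
  then show ?thesis unfolding hessian_def by (rule frechet_derivative_at[symmetric])
qed

text \<open>
  The meaning of the sensitivity factor: it is the reciprocal of the barrier's curvature on the
  eigenvalue scale.
\<close>

lemma sens_factor_eq_curv:
  assumes "0 < x"
  shows "sens_factor q \<eta> x = 1 / barrier_curv q \<eta> x"
proof -
  have "x powr (- q - 1) * x\<^sup>2 = x powr (- (q - 1))"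
    using assms powr_add[of x "- q - 1" 2] by (simp add: powr_numeral)
  moreover have "x powr (- 2) * x\<^sup>2 = 1"
    using assms powr_add[of x "- 2" 2] by (simp add: powr_numeral)
  ultimately have "barrier_curv q \<eta> x * x\<^sup>2 = 1 + \<eta> * q * x powr (- (q - 1))"
    by (simp add: barrier_curv_def algebra_simps)
  then have "sens_factor q \<eta> x = x\<^sup>2 / (barrier_curv q \<eta> x * x\<^sup>2)" by (simp only: sens_factor_def)
  then show ?thesis using assms by simp
qed

lemma barrier_curv_pos: "1 < q \<Longrightarrow> 0 \<le> \<eta> \<Longrightarrow> 0 < x \<Longrightarrow> 0 < barrier_curv q \<eta> x"
  by (simp add: barrier_curv_def add_pos_nonneg)

lemma barrier_curv_antimono:
  "1 < q \<Longrightarrow> 0 \<le> \<eta> \<Longrightarrow> 0 < x \<Longrightarrow> x \<le> y \<Longrightarrow> barrier_curv q \<eta> y \<le> barrier_curv q \<eta> x"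
  unfolding barrier_curv_def by (intro add_mono mult_left_mono powr_mono2') auto

lemma ddiff_barrier_slope_bounds:
  assumes "1 < q" "0 \<le> \<eta>" "0 < l" "x \<in> {l..L}" "y \<in> {l..L}"
  shows "ddiff (barrier_slope q \<eta>) (barrier_curv q \<eta>) x y
    \<in> {barrier_curv q \<eta> L..barrier_curv q \<eta> l}"
proof -
  have "\<exists>z\<in>{min x y..max x y}. ddiff (barrier_slope q \<eta>) (barrier_curv q \<eta>) x y = barrier_curv q \<eta> z"
    using assms by (intro ddiff_mean_value barrier_slope_deriv) auto
  then obtain z where z: "z \<in> {min x y..max x y}"
    "ddiff (barrier_slope q \<eta>) (barrier_curv q \<eta>) x y = barrier_curv q \<eta> z" by blast
  then have "z \<in> {l..L}" using assms by (auto simp: min_def max_def split: if_splits)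
  with z(2) show ?thesis using assms by (auto intro!: barrier_curv_antimono)
qed

section \<open>Strongly monotone maps and bounded lifts\<close>

text \<open>
  Only right-hand sides in the range are lifted, because the constraint map may fail to be onto.
\<close>

definition bounded_lift :: "real \<Rightarrow> ('a::real_normed_vector \<Rightarrow> 'b::real_normed_vector) \<Rightarrow> bool"
  where "bounded_lift K f \<longleftrightarrow> 0 < K \<and> (\<forall>b\<in>range f. \<exists>h. f h = b \<and> norm h \<le> K * norm b)"

lemma linear_bounded_lift:
  fixes f :: "'a::euclidean_space \<Rightarrow> 'b::euclidean_space"
  assumes "linear f"
  shows "\<exists>K. bounded_lift K f"
proof -
  obtain g where g: "linear g" "\<forall>v\<in>range f. f (g v) = v"
    using linear_exists_right_inverse_on[OF assms subspace_UNIV] by blast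
  obtain K where "0 < K" "\<And>x. norm (g x) \<le> K * norm x"
    using linear_bounded_pos[OF g(1)] by blast
  with g(2) show ?thesis unfolding bounded_lift_def by blast
qed

text \<open>
  On \<open>P\<close> the map \<open>g\<close> is merely monotone, and its strong monotonicity and Lipschitz bound are local
  at \<open>X\<close>, whereas \<open>X'\<close> may lie anywhere in \<open>P\<close>. Strong monotonicity is applied to the point \<open>Z\<close>
  reached from \<open>Y\<close> in the direction of \<open>X'\<close> without leaving the ball, and plain monotonicity carries
  the resulting inequality from \<open>Z\<close> on to \<open>X'\<close>. The smallness of \<open>Y - X\<close> then forces \<open>Z = X'\<close>.
\<close>

lemma strongly_monotone_lipschitz_inverse:
  fixes g :: "'a::real_inner \<Rightarrow> 'a"
  assumes ball: "\<And>Z. norm (Z - X) \<le> \<rho> \<Longrightarrow> Z \<in> P" and \<rho>: "0 < \<rho>" and c: "0 < c"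
    and mono: "\<And>Y Z. Y \<in> P \<Longrightarrow> Z \<in> P \<Longrightarrow> 0 \<le> (g Y - g Z) \<bullet> (Y - Z)"
    and strong: "\<And>Y Z. norm (Y - X) \<le> \<rho> \<Longrightarrow> norm (Z - X) \<le> \<rho> \<Longrightarrow>
      c * (norm (Y - Z))\<^sup>2 \<le> (g Y - g Z) \<bullet> (Y - Z)"
    and lip: "\<And>Y. norm (Y - X) \<le> \<rho> \<Longrightarrow> norm (g Y - g X) \<le> d * norm (Y - X)"
    and X': "X' \<in> P" and orth: "(g X' - g X) \<bullet> (X' - Y) = 0"
    and Y: "norm (Y - X) \<le> \<rho> / 2" "d * norm (Y - X) < c * \<rho> / 2"
  shows "c * norm (X' - Y) \<le> d * norm (Y - X)"
proof (cases "X' = Y")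
  case True
  have "0 \<le> d * norm (Y - X)" using order_trans[OF norm_ge_zero lip, of Y] Y(1) \<rho> by simp
  then show ?thesis using True by simp
next
  case False
  define W where "W = X' - Y"
  have W: "0 < norm W" using False by (simp add: W_def)
  define t where "t = min 1 (\<rho> / 2 / norm W)"
  have t: "0 < t" "t \<le> 1" "t * norm W \<le> \<rho> / 2"
    using W \<rho> by (auto simp: t_def min_def field_simps)
  define Z where "Z = Y + t *\<^sub>R W"
  have Yb: "norm (Y - X) \<le> \<rho>" using Y(1) \<rho> by simp
  have "norm (Z - X) \<le> norm (Y - X) + norm (t *\<^sub>R W)"
    using norm_triangle_ineq[of "Y - X" "t *\<^sub>R W"] by (simp add: Z_def algebra_simps)
  then have Zb: "norm (Z - X) \<le> \<rho>" using Y(1) t by simp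
  have "c * t * (norm W)\<^sup>2 \<le> (g Z - g Y) \<bullet> W"
  proof -
    have "c * (norm (Z - Y))\<^sup>2 \<le> (g Z - g Y) \<bullet> (Z - Y)" by (rule strong[OF Zb Yb])
    then have "t * (c * t * (norm W)\<^sup>2) \<le> t * ((g Z - g Y) \<bullet> W)"
      using t by (simp add: Z_def power2_eq_square mult_ac)
    then show ?thesis using t by simp
  qed
  moreover have "0 \<le> (g X' - g Z) \<bullet> W"
  proof (cases "t = 1")
    case True
    then show ?thesis by (simp add: Z_def W_def)
  next
    case False
    have "0 \<le> (g X' - g Z) \<bullet> (X' - Z)" by (rule mono[OF X' ball[OF Zb]])
    also have "X' - Z = (1 - t) *\<^sub>R W" by (simp add: Z_def W_def algebra_simps)
    finally show ?thesis using False t by (simp add: zero_le_mult_iff)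
  qed
  moreover have "(g Z - g Y) \<bullet> W + (g X' - g Z) \<bullet> W = (g X - g Y) \<bullet> W"
    using orth by (simp add: W_def inner_diff_left)
  moreover have "(g X - g Y) \<bullet> W \<le> d * norm (Y - X) * norm W"
    using lip[OF Yb]
    by (intro order_trans[OF norm_cauchy_schwarz] mult_right_mono) (simp_all add: norm_minus_commute)
  ultimately have "(c * (t * norm W)) * norm W \<le> (d * norm (Y - X)) * norm W"
    by (simp add: power2_eq_square mult_ac)
  then have le: "c * (t * norm W) \<le> d * norm (Y - X)" using W by simp
  then have "c * (t * norm W) < c * (\<rho> / 2)" using Y(2) by simp
  then have "t * norm W < \<rho> / 2" using c by simp
  then have "t = 1" using W by (auto simp: t_def min_def split: if_splits)
  with le show ?thesis by (simp add: W_def)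
qed

section \<open>First-order bounds for central points and responses\<close>

text \<open>
  The divided differences of the slope are values of the curvature between two eigenvalues, and the
  curvature decreases: it is smallest at the largest eigenvalue and largest at the smallest one.
\<close>

lemma inner_barrier_gradient_diff:
  fixes Y Z :: "('n::finite) sym_mat"
  assumes q: "1 < q" "0 \<le> \<eta>" and l: "0 < l"
    and Y: "\<And>x. x \<in> eigenvalues Y \<Longrightarrow> x \<in> {l..L}" and Z: "\<And>x. x \<in> eigenvalues Z \<Longrightarrow> x \<in> {l..L}"
  defines "g \<equiv> spectral_fun (barrier_slope q \<eta>)"
  shows "barrier_curv q \<eta> L * (norm (Y - Z))\<^sup>2 \<le> (g Y - g Z) \<bullet> (Y - Z)"
    and "norm (g Y - g Z) \<le> barrier_curv q \<eta> l * norm (Y - Z)"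
proof -
  obtain mu d where EY: "eigenbasis Y mu d" using eigenbasis_exists by blast
  obtain nu e where EZ: "eigenbasis Z nu e" using eigenbasis_exists by blast
  have b: "ddiff (barrier_slope q \<eta>) (barrier_curv q \<eta>) (mu i) (nu j)
      \<in> {barrier_curv q \<eta> L..barrier_curv q \<eta> l}" for i j
    by (rule ddiff_barrier_slope_bounds[OF q l Y Z])
      (simp_all add: eigenvalues_eq_range[OF EY] eigenvalues_eq_range[OF EZ])
  have "mu i \<in> {l..L}" for i using Y by (auto simp: eigenvalues_eq_range[OF EY])
  from this[of undefined] have "0 < barrier_curv q \<eta> L"
    using l q by (intro barrier_curv_pos) auto
  with b have "\<bar>ddiff (barrier_slope q \<eta>) (barrier_curv q \<eta>) (mu i) (nu j)\<bar> \<le> barrier_curv q \<eta> l" for i j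
    by (smt (verit) atLeastAtMost_iff)
  then show "norm (g Y - g Z) \<le> barrier_curv q \<eta> l * norm (Y - Z)"
    unfolding g_def by (rule norm_spectral_fun_diff_le[OF EY EZ])
  show "barrier_curv q \<eta> L * (norm (Y - Z))\<^sup>2 \<le> (g Y - g Z) \<bullet> (Y - Z)"
    unfolding g_def using b by (intro inner_spectral_fun_diff_ge[OF EY EZ]) auto
qed

lemma eigenvalues_subset:
  assumes "x \<in> eigenvalues Y"
  shows "x \<in> {lambda_min Y..lambda_max Y}"
proof -
  obtain mu d where Y: "eigenbasis Y mu d" using eigenbasis_exists by blast
  show ?thesis using assms eigenvalue_bounds[OF Y] unfolding eigenvalues_eq_range[OF Y] by blast
qed

lemma barrier_gradient_monotone:
  fixes Y Z :: "('n::finite) sym_mat"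
  assumes q: "1 < q" "0 \<le> \<eta>" and "pos_def Y" "pos_def Z"
  shows "0 \<le> (spectral_fun (barrier_slope q \<eta>) Y - spectral_fun (barrier_slope q \<eta>) Z) \<bullet> (Y - Z)"
proof -
  define l where "l = min (lambda_min Y) (lambda_min Z)"
  define L where "L = max (lambda_max Y) (lambda_max Z)"
  have l: "0 < l" "0 < L" using lambda_pos[OF assms(3)] lambda_pos[OF assms(4)] by (auto simp: l_def L_def)
  have "0 \<le> barrier_curv q \<eta> L * (norm (Y - Z))\<^sup>2"
    using barrier_curv_pos[OF q l(2)] by simp
  also have "\<dots> \<le> (spectral_fun (barrier_slope q \<eta>) Y - spectral_fun (barrier_slope q \<eta>) Z) \<bullet> (Y - Z)"
    by (rule inner_barrier_gradient_diff[OF q l(1)])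
      (use eigenvalues_subset[of _ Y] eigenvalues_subset[of _ Z] in \<open>force simp: l_def L_def\<close>)+
  finally show ?thesis .
qed

text \<open>
  By the optimality conditions the difference of the two gradients lies in the range of the adjoint
  of \<open>A\<close>, which is orthogonal to the kernel of \<open>A\<close>.
\<close>

lemma central_point_difference:
  fixes A :: "('n::finite) sym_mat \<Rightarrow> real^'m::finite"
  assumes A: "linear A" and \<mu>: "0 < \<mu>" and q: "1 < q"
    and X: "central_point q \<eta> \<mu> A C b X" and X': "central_point q \<eta> \<mu> A C b' X'"
    and W: "A W = 0"
  shows "(spectral_fun (barrier_slope q \<eta>) X' - spectral_fun (barrier_slope q \<eta>) X) \<bullet> W = 0"
proof -
  let ?g = "spectral_fun (barrier_slope q \<eta>)"
  obtain y y' where y: "C + \<mu> *\<^sub>R ?g X + adjoint A y = 0" and y': "C + \<mu> *\<^sub>R ?g X' + adjoint A y' = 0"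
    using X X' by (auto simp: central_point_def gradient_barrier[OF q])
  have zero: "adjoint A y \<bullet> W = 0" for y
    using adjoint_works[OF A, of W y] W by (simp add: inner_commute)
  have "0 = (C + \<mu> *\<^sub>R ?g X' + adjoint A y') \<bullet> W - (C + \<mu> *\<^sub>R ?g X + adjoint A y) \<bullet> W"
    by (simp only: y y' inner_zero_left diff_0_right)
  also have "\<dots> = \<mu> * ((?g X' - ?g X) \<bullet> W)"
    by (simp add: inner_add_left inner_diff_left zero algebra_simps)
  finally show ?thesis using \<mu> by simp
qed

text \<open>
  Let \<open>H\<close> be a bounded lift of \<open>b' - b\<close>. Then \<open>X' - (X + H)\<close> lies in the kernel of \<open>A\<close>, so the monotonicity
  lemma applies with \<open>Y = X + H\<close>. On a small ball around \<open>X\<close> the gradient is strongly monotone with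
  half the curvature at \<open>\<lambda>\<^sub>m\<^sub>a\<^sub>x\<close> and Lipschitz with twice the curvature at \<open>\<lambda>\<^sub>m\<^sub>i\<^sub>n\<close>, which bounds
  the norm of \<open>X' - (X + H)\<close> by that of \<open>H\<close> times four times the curvature ratio. As the ratio is at
  least \<open>1\<close>, adding \<open>H\<close> back raises the factor to at most five. Continuity of the central path at \<open>b\<close>
  comes out of the same estimate.
\<close>

lemma central_point_locally_lipschitz:
  fixes A :: "('n::finite) sym_mat \<Rightarrow> real^'m::finite"
  assumes A: "linear A" and \<mu>: "0 < \<mu>" and q: "1 < q" "0 \<le> \<eta>" and K: "bounded_lift K A"
    and X: "central_point q \<eta> \<mu> A C b X"
  shows "\<exists>\<delta>>0. \<forall>b' X'. central_point q \<eta> \<mu> A C b' X' \<and> norm (b' - b) < \<delta> \<longrightarrow>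
    norm (X' - X) \<le> 5 * K * (sens_factor q \<eta> (lambda_max X) / sens_factor q \<eta> (lambda_min X)) * norm (b' - b)"
proof -
  let ?g = "spectral_fun (barrier_slope q \<eta>)" and ?k = "barrier_curv q \<eta>"
  define l where "l = lambda_min X"
  define L where "L = lambda_max X"
  have pd: "pos_def X" using X by (simp add: central_point_def)
  have l: "0 < l" "l \<le> L" using lambda_pos[OF pd] by (auto simp: l_def L_def)
  have kl: "0 < ?k l" "0 < ?k L" "?k L \<le> ?k l"
    using l q by (auto intro!: barrier_curv_pos barrier_curv_antimono)
  have cont: "isCont ?k x" if "0 < x" for x
    by (rule DERIV_isCont[OF barrier_curv_deriv[OF that]])
  have "((\<lambda>r. ?k (l - r)) \<longlongrightarrow> ?k (l - 0)) (at_right 0)"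
    using l by (intro isCont_tendsto_compose[where g = ?k] cont tendsto_intros) simp
  then have "\<forall>\<^sub>F r in at_right 0. ?k (l - r) < 2 * ?k l"
    by (rule order_tendstoD(2)) (use kl in simp)
  moreover have "((\<lambda>r. ?k (L + r)) \<longlongrightarrow> ?k (L + 0)) (at_right 0)"
    using l by (intro isCont_tendsto_compose[where g = ?k] cont tendsto_intros) simp
  then have "\<forall>\<^sub>F r in at_right 0. ?k L / 2 < ?k (L + r)"
    by (rule order_tendstoD(1)) (use kl in simp)
  moreover have "\<forall>\<^sub>F r in at_right 0. r \<in> {0<..<l}"
    by (rule eventually_at_right_real[OF l(1)])
  ultimately have "\<forall>\<^sub>F r in at_right 0. ?k (l - r) < 2 * ?k l \<and> ?k L / 2 < ?k (L + r) \<and> r \<in> {0<..<l}"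
    by eventually_elim simp
  then obtain \<rho> where "?k (l - \<rho>) < 2 * ?k l \<and> ?k L / 2 < ?k (L + \<rho>) \<and> \<rho> \<in> {0<..<l}"
    using eventually_happens'[OF trivial_limit_at_right_real] by blast
  then have \<rho>: "0 < \<rho>" "\<rho> < l" "?k (l - \<rho>) < 2 * ?k l" "?k L / 2 < ?k (L + \<rho>)"
    by auto
  have near: "x \<in> {l - \<rho>..L + \<rho>}" if "norm (Y - X) \<le> \<rho>" "x \<in> eigenvalues Y" for x Y
  proof -
    obtain mu d where Y: "eigenbasis Y mu d" using eigenbasis_exists by blast
    show ?thesis
      using eigenvalues_near[OF pd Y that(1)] that(2)
      unfolding l_def L_def eigenvalues_eq_range[OF Y] by blast
  qed
  define c where "c = ?k L / 2"
  define d where "d = 2 * ?k l"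
  have cd: "0 < c" "0 < d" using kl by (auto simp: c_def d_def)
  have "0 < K" using K by (simp add: bounded_lift_def)
  define \<delta> where "\<delta> = min (\<rho> / 2) (c * \<rho> / (2 * d)) / K"
  have \<delta>: "0 < \<delta>" using \<rho> cd \<open>0 < K\<close> by (simp add: \<delta>_def)
  have "norm (X' - X) \<le> 5 * K * (?k l / ?k L) * norm (b' - b)"
    if X': "central_point q \<eta> \<mu> A C b' X'" and small: "norm (b' - b) < \<delta>" for b' X'
  proof -
    have eq: "A X = b" "A X' = b'" and pd': "pos_def X'"
      using X X' by (auto simp: central_point_def)
    have "b' - b = A (X' - X)" by (simp add: linear_diff[OF A] eq)
    then have "b' - b \<in> range A" by blast
    then obtain H where H: "A H = b' - b" "norm H \<le> K * norm (b' - b)"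
      using K unfolding bounded_lift_def by blast
    have "K * norm (b' - b) < min (\<rho> / 2) (c * \<rho> / (2 * d))"
      using small \<open>0 < K\<close> by (simp add: \<delta>_def pos_less_divide_eq mult.commute)
    with H(2) have Hs: "norm H \<le> \<rho> / 2" "norm H < c * \<rho> / (2 * d)" by auto
    have "c * norm (X' - (X + H)) \<le> d * norm ((X + H) - X)"
    proof (rule strongly_monotone_lipschitz_inverse[where P = "{X. pos_def X}" and \<rho> = \<rho> and g = ?g])
      show "Z \<in> {X. pos_def X}" if "norm (Z - X) \<le> \<rho>" for Z
        using pos_def_near[OF pd, of Z] that \<rho>(2) by (simp add: l_def)
      show "0 \<le> (?g Y - ?g Z) \<bullet> (Y - Z)" if "Y \<in> {X. pos_def X}" "Z \<in> {X. pos_def X}" for Y Z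
        using barrier_gradient_monotone[OF q] that by simp
      show "c * (norm (Y - Z))\<^sup>2 \<le> (?g Y - ?g Z) \<bullet> (Y - Z)"
        if "norm (Y - X) \<le> \<rho>" "norm (Z - X) \<le> \<rho>" for Y Z
      proof -
        have "c * (norm (Y - Z))\<^sup>2 \<le> ?k (L + \<rho>) * (norm (Y - Z))\<^sup>2"
          using \<rho>(4) by (intro mult_right_mono) (auto simp: c_def)
        also have "\<dots> \<le> (?g Y - ?g Z) \<bullet> (Y - Z)"
          using \<rho>(2) near that by (intro inner_barrier_gradient_diff[OF q, of "l - \<rho>"]) auto
        finally show ?thesis .
      qed
      show "norm (?g Y - ?g X) \<le> d * norm (Y - X)" if "norm (Y - X) \<le> \<rho>" for Y
      proof -
        have "norm (?g Y - ?g X) \<le> ?k (l - \<rho>) * norm (Y - X)"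
          using \<rho>(1,2) near that near[of X]
          by (intro inner_barrier_gradient_diff(2)[OF q, of "l - \<rho>" _ "L + \<rho>"]) auto
        also have "\<dots> \<le> d * norm (Y - X)"
          using \<rho>(3) by (intro mult_right_mono) (auto simp: d_def)
        finally show ?thesis .
      qed
      show "(?g X' - ?g X) \<bullet> (X' - (X + H)) = 0"
        by (rule central_point_difference[OF A \<mu> q(1) X X'])
          (simp add: linear_diff[OF A] linear_add[OF A] eq H(1))
      show "d * norm ((X + H) - X) < c * \<rho> / 2"
        using Hs(2) cd by (simp add: field_simps)
    qed (use \<rho> cd Hs pd' in auto)
    then have W: "norm (X' - (X + H)) \<le> 4 * (?k l / ?k L) * norm H"
      using kl by (simp add: c_def d_def field_simps)
    have "norm (X' - X) \<le> norm (X' - (X + H)) + norm H"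
      using norm_triangle_ineq[of "X' - (X + H)" H] by simp
    also have "\<dots> \<le> 4 * (?k l / ?k L) * norm H + (?k l / ?k L) * norm H"
      using kl by (intro add_mono W mult_le_cancel_right1[THEN iffD2]) auto
    also have "\<dots> = 5 * (?k l / ?k L) * norm H" by simp
    also have "\<dots> \<le> 5 * (?k l / ?k L) * (K * norm (b' - b))"
      using kl by (intro mult_left_mono H(2)) auto
    finally show ?thesis by (simp add: mult_ac)
  qed
  then show ?thesis
    using \<delta> l by (intro exI[of _ \<delta>]) (simp add: sens_factor_eq_curv l_def L_def)
qed

text \<open>
  The response minimises the energy \<open>\<Sum>\<^sub>i\<^sub>j m\<^sub>i\<^sub>j x\<^sub>i\<^sub>j\<^sup>2\<close> of the Hessian among all matrices with the same image
  under \<open>A\<close>, so its energy is at most that of a bounded lift \<open>H\<close>. The single entry \<open>x\<^sub>k\<^sub>k\<close> contributes to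
  it with weight the curvature at \<open>\<lambda>\<^sub>k\<close>, and all weights are at most the curvature at \<open>\<lambda>\<^sub>m\<^sub>i\<^sub>n\<close>. This
  bounds \<open>x\<^sub>k\<^sub>k\<close> by the square root of the curvature ratio \<open>r\<close>, which is at most \<open>r\<close> because \<open>r \<ge> 1\<close>.
\<close>

lemma response_diagonal_bound:
  fixes A :: "('n::finite) sym_mat \<Rightarrow> real^'m::finite"
  assumes A: "linear A" and \<mu>: "0 < \<mu>" and q: "1 < q" "0 \<le> \<eta>" and K: "bounded_lift K A"
    and pd: "pos_def X" and X: "eigenbasis X lam e"
    and R: "response \<mu> A (hessian (barrier q \<eta>) X) \<Delta>b \<Delta>X"
  shows "\<bar>bform \<Delta>X (e k) (e k)\<bar>
    \<le> K * (sens_factor q \<eta> (lam k) / sens_factor q \<eta> (lambda_min X)) * norm \<Delta>b"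
proof -
  note oe = eigenbasis_orthonormal[OF X]
  let ?k = "barrier_curv q \<eta>"
  define m where "m i j = ddiff (barrier_slope q \<eta>) ?k (lam i) (lam j)" for i j
  define M where "M = hessian (barrier q \<eta>) X"
  have M: "bform (M D) (e i) (e j) = m i j * bform D (e i) (e j)" for D i j
    unfolding M_def hessian_barrier[OF q(1) pd X] m_def by (rule bform_spectral_deriv[OF oe])
  define l where "l = lambda_min X"
  define L where "L = lambda_max X"
  have l: "0 < l" "l \<le> L" using lambda_pos[OF pd] by (auto simp: l_def L_def)
  have lam: "lam i \<in> {l..L}" for i using eigenvalue_bounds[OF X] by (simp add: l_def L_def)
  have m: "?k L \<le> m i j" "m i j \<le> ?k l" for i j
    using ddiff_barrier_slope_bounds[OF q l(1) lam lam] by (auto simp: m_def)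
  have m0: "0 \<le> m i j" for i j
    using m(1)[of i j] barrier_curv_pos[OF q, of L] l by simp
  have lamk: "0 < lam k" using lam[of k] l by simp
  have kpos: "0 < ?k l" "0 < ?k (lam k)" "?k (lam k) \<le> ?k l"
    using l lamk q lam[of k] by (auto intro!: barrier_curv_pos barrier_curv_antimono)
  obtain y where y: "\<mu> *\<^sub>R M \<Delta>X + adjoint A y = 0" and b: "A \<Delta>X = \<Delta>b"
    using R by (auto simp: response_def M_def)
  obtain H where H: "A H = \<Delta>b" "norm H \<le> K * norm \<Delta>b"
    using K b unfolding bounded_lift_def by blast
  have "adjoint A y \<bullet> (\<Delta>X - H) = 0"
    using adjoint_works[OF A, of "\<Delta>X - H" y] by (simp add: linear_diff[OF A] b H(1) inner_commute)
  moreover have "(\<mu> *\<^sub>R M \<Delta>X + adjoint A y) \<bullet> (\<Delta>X - H) = 0" by (simp add: y)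
  ultimately have orth: "M \<Delta>X \<bullet> (\<Delta>X - H) = 0" using \<mu> by (simp add: inner_add_left)
  let ?x = "\<lambda>i j. bform \<Delta>X (e i) (e j)" and ?h = "\<lambda>i j. bform H (e i) (e j)"
  have zero: "(\<Sum>i\<in>UNIV. \<Sum>j\<in>UNIV. m i j * ?x i j * (?x i j - ?h i j)) = 0"
    using orth unfolding inner_sym_mat_bform[OF oe oe] M bform_minus .
  have energy: "(\<Sum>i\<in>UNIV. \<Sum>j\<in>UNIV. m i j * (?x i j)\<^sup>2) \<le> (\<Sum>i\<in>UNIV. \<Sum>j\<in>UNIV. m i j * (?h i j)\<^sup>2)"
  proof -
    have "(\<Sum>i\<in>UNIV. \<Sum>j\<in>UNIV. m i j * (?x i j)\<^sup>2)
        \<le> (\<Sum>i\<in>UNIV. \<Sum>j\<in>UNIV. m i j * (?h i j)\<^sup>2 + 2 * (m i j * ?x i j * (?x i j - ?h i j)))"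
    proof (intro sum_mono)
      fix i j
      have "0 \<le> m i j * (?x i j - ?h i j)\<^sup>2" using m0 by simp
      then show "m i j * (?x i j)\<^sup>2 \<le> m i j * (?h i j)\<^sup>2 + 2 * (m i j * ?x i j * (?x i j - ?h i j))"
        by (simp add: power2_eq_square algebra_simps)
    qed
    also have "\<dots> = (\<Sum>i\<in>UNIV. \<Sum>j\<in>UNIV. m i j * (?h i j)\<^sup>2)"
      by (simp only: sum.distrib sum_distrib_left[symmetric] zero mult_zero_right add_0_right)
    finally show ?thesis .
  qed
  have "?k (lam k) * (?x k k)\<^sup>2 = m k k * (?x k k)\<^sup>2" by (simp add: m_def)
  also have "\<dots> \<le> (\<Sum>j\<in>UNIV. m k j * (?x k j)\<^sup>2)"
    using m0 by (intro member_le_sum[of k UNIV "\<lambda>j. m k j * (?x k j)\<^sup>2"]) auto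
  also have "\<dots> \<le> (\<Sum>i\<in>UNIV. \<Sum>j\<in>UNIV. m i j * (?x i j)\<^sup>2)"
    using m0 by (intro member_le_sum[of k UNIV "\<lambda>i. \<Sum>j\<in>UNIV. m i j * (?x i j)\<^sup>2"]) (auto intro: sum_nonneg)
  also note energy
  also have "(\<Sum>i\<in>UNIV. \<Sum>j\<in>UNIV. m i j * (?h i j)\<^sup>2) \<le> (\<Sum>i\<in>UNIV. \<Sum>j\<in>UNIV. ?k l * (?h i j)\<^sup>2)"
    by (intro sum_mono mult_right_mono m) simp
  also have "\<dots> = ?k l * (norm H)\<^sup>2" by (simp add: norm_sym_mat_bform[OF oe oe] sum_distrib_left)
  finally have le: "(?x k k)\<^sup>2 \<le> (?k l / ?k (lam k)) * (norm H)\<^sup>2"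
    using kpos by (simp add: field_simps)
  define r where "r = ?k l / ?k (lam k)"
  have r: "1 \<le> r" using kpos by (simp add: r_def)
  have "(?x k k)\<^sup>2 \<le> (r * norm H)\<^sup>2"
  proof -
    have "r * (norm H)\<^sup>2 \<le> r\<^sup>2 * (norm H)\<^sup>2"
      using r by (intro mult_right_mono) (auto simp: power2_eq_square)
    with le show ?thesis
      unfolding power_mult_distrib r_def[symmetric] by (rule order_trans)
  qed
  then have "\<bar>?x k k\<bar> \<le> r * norm H"
    using r by (simp add: abs_le_square_iff[symmetric])
  also have "\<dots> \<le> r * (K * norm \<Delta>b)" using r by (intro mult_left_mono H(2)) auto
  finally show ?thesis
    using l lamk by (simp add: r_def sens_factor_eq_curv l_def mult_ac)
qed

section \<open>The sensitivity constant and its limits\<close>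

definition lift_const :: "('n::finite sym_mat \<Rightarrow> real^'m::finite) \<Rightarrow> real"
  where "lift_const A = (SOME K. bounded_lift K A)"

lemma bounded_lift_lift_const: "linear A \<Longrightarrow> bounded_lift (lift_const A) A"
  unfolding lift_const_def by (rule someI_ex) (rule linear_bounded_lift)

lemma lift_const_pos: "linear A \<Longrightarrow> 0 < lift_const A"
  using bounded_lift_lift_const by (auto simp: bounded_lift_def)

text \<open>
  The denominator turns the sensitivity factor at \<open>\<lambda>\<close> into the curvature ratio of \<open>\<lambda>\<^sub>m\<^sub>i\<^sub>n\<close> and \<open>\<lambda>\<close>, and
  makes the bound continuous at the log-det barrier: as \<open>q\<close> tends to \<open>1\<close> both sensitivity factors
  tend to \<open>1 / (1 + \<eta>)\<close> times their log-det values, and these factors cancel. The number \<open>5\<close> is the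
  factor from \<open>central_point_locally_lipschitz\<close>.
\<close>

definition sens_const :: "real \<Rightarrow> real \<Rightarrow> real \<Rightarrow> ('n::finite sym_mat \<Rightarrow> real^'m::finite) \<Rightarrow> real \<Rightarrow> real"
  where "sens_const q \<eta> \<mu> A l = 5 * \<mu> * lift_const A / sens_factor q \<eta> l"

lemma sens_factor_pos: "1 < q \<Longrightarrow> 0 \<le> \<eta> \<Longrightarrow> 0 < x \<Longrightarrow> 0 < sens_factor q \<eta> x"
  by (simp add: sens_factor_eq_curv barrier_curv_pos)

lemma sens_const_pos:
  "1 < q \<Longrightarrow> 0 \<le> \<eta> \<Longrightarrow> 0 < \<mu> \<Longrightarrow> linear A \<Longrightarrow> 0 < l \<Longrightarrow> 0 < sens_const q \<eta> \<mu> A l"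
  by (simp add: sens_const_def lift_const_pos sens_factor_pos)

lemma sens_factor_zero: "0 < x \<Longrightarrow> sens_factor q 0 x = x\<^sup>2"
  by (simp add: sens_factor_def)

lemma sens_factor_less_square:
  assumes "1 < q" "0 < \<eta>" "0 < x"
  shows "sens_factor q \<eta> x < x\<^sup>2"
  using assms by (simp add: sens_factor_def divide_less_eq add_pos_pos)

lemma sens_factor_tendsto_eta_0:
  assumes "0 < L"
  shows "((\<lambda>\<eta>. sens_factor q \<eta> L) \<longlongrightarrow> L\<^sup>2) (at_right 0)"
  unfolding sens_factor_def by (auto intro!: tendsto_eq_intros)

lemma sens_factor_tendsto_q_1:
  assumes "0 < L" "0 \<le> \<eta>"
  shows "((\<lambda>q. sens_factor q \<eta> L) \<longlongrightarrow> L\<^sup>2 / (1 + \<eta>)) (at_right 1)"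
  unfolding sens_factor_def using assms by (auto intro!: tendsto_eq_intros)

lemma sens_const_mult:
  assumes "0 < \<mu>"
  shows "sens_const q \<eta> \<mu> A l / \<mu> * s = 5 * lift_const A * (s / sens_factor q \<eta> l)"
  using assms by (simp add: sens_const_def)

lemma sens_bound_tendsto_eta_0:
  assumes "0 < \<mu>" "0 < l" "0 < L"
  shows "((\<lambda>\<eta>. sens_const q \<eta> \<mu> A l / \<mu> * sens_factor q \<eta> L)
    \<longlongrightarrow> sens_const q 0 \<mu> A l / \<mu> * L\<^sup>2) (at_right 0)"
  unfolding sens_const_mult[OF assms(1)] sens_factor_zero[OF assms(2)]
  using assms by (intro tendsto_intros sens_factor_tendsto_eta_0) auto

lemma sens_bound_tendsto_q_1:
  assumes "0 < \<mu>" "0 < l" "0 < L" "0 \<le> \<eta>"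
  shows "((\<lambda>q. sens_const q \<eta> \<mu> A l / \<mu> * sens_factor q \<eta> L)
    \<longlongrightarrow> sens_const p 0 \<mu> A l / \<mu> * L\<^sup>2) (at_right 1)"
proof -
  have "((\<lambda>q. 5 * lift_const A * (sens_factor q \<eta> L / sens_factor q \<eta> l))
      \<longlongrightarrow> 5 * lift_const A * ((L\<^sup>2 / (1 + \<eta>)) / (l\<^sup>2 / (1 + \<eta>)))) (at_right 1)"
    using assms by (intro tendsto_intros sens_factor_tendsto_q_1) auto
  also have "(L\<^sup>2 / (1 + \<eta>)) / (l\<^sup>2 / (1 + \<eta>)) = L\<^sup>2 / l\<^sup>2"
  proof -
    have "1 + \<eta> \<noteq> 0" using assms by simp
    then show ?thesis by simp
  qed
  finally show ?thesis
    unfolding sens_const_mult[OF assms(1)] sens_factor_zero[OF assms(2)] .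
qed

lemma constant_bound_tendsto_eta_0:
  fixes c :: real
  assumes "0 < L"
  shows "((\<lambda>\<eta>. c / \<mu> * sens_factor q \<eta> L) \<longlongrightarrow> c / \<mu> * L\<^sup>2) (at_right 0)"
  by (intro tendsto_intros sens_factor_tendsto_eta_0 assms)

lemma constant_bound_tendsto_q_1:
  fixes c :: real
  assumes "0 < L" "0 \<le> \<eta>"
  shows "((\<lambda>q. c / \<mu> * sens_factor q \<eta> L) \<longlongrightarrow> c / ((1 + \<eta>) * \<mu>) * L\<^sup>2) (at_right 1)"
proof -
  have "((\<lambda>q. c / \<mu> * sens_factor q \<eta> L) \<longlongrightarrow> c / \<mu> * (L\<^sup>2 / (1 + \<eta>))) (at_right 1)"
    by (intro tendsto_intros sens_factor_tendsto_q_1 assms)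
  then show ?thesis by (simp add: mult.commute)
qed

section \<open>Vanishing eigenvalues\<close>

lemma powr_tendsto_0_at_right: "0 < a \<Longrightarrow> ((\<lambda>l::real. l powr a) \<longlongrightarrow> 0) (at_right 0)"
proof -
  assume a: "0 < a"
  have "((\<lambda>l::real. l powr a) \<longlongrightarrow> 0 powr a) (at_right 0)"
    using a by (intro tendsto_powr')
      (auto intro!: tendsto_intros simp: eventually_at_right_less less_imp_le eventually_mono[OF eventually_at_right_less])
  then show ?thesis using a by simp
qed

lemma sens_factor_eq_ratio:
  assumes "0 < l"
  shows "sens_factor q \<eta> l = l powr (q - 1) / (l powr (q - 1) + \<eta> * q) * l\<^sup>2"
proof -
  have p: "l powr (- (q - 1)) = 1 / l powr (q - 1)" by (rule powr_minus_divide)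
  have "0 < l powr (q - 1)" using assms by simp
  then show ?thesis unfolding sens_factor_def p by (simp add: field_simps)
qed

lemma sens_factor_ratio_tendsto:
  fixes q \<eta> :: real
  assumes "1 < q" "0 < \<eta>"
  shows "((\<lambda>l. l powr (q - 1) / (l powr (q - 1) + \<eta> * q)) \<longlongrightarrow> 0) (at_right 0)"
    and "((\<lambda>l. \<eta> * q / (l powr (q - 1) + \<eta> * q)) \<longlongrightarrow> 1) (at_right 0)"
proof -
  note p = powr_tendsto_0_at_right[of "q - 1"]
  have "((\<lambda>l. l powr (q - 1) / (l powr (q - 1) + \<eta> * q)) \<longlongrightarrow> 0 / (0 + \<eta> * q)) (at_right 0)"
    using assms by (intro tendsto_intros p) auto
  then show "((\<lambda>l. l powr (q - 1) / (l powr (q - 1) + \<eta> * q)) \<longlongrightarrow> 0) (at_right 0)" by simp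
  have "((\<lambda>l. \<eta> * q / (l powr (q - 1) + \<eta> * q)) \<longlongrightarrow> \<eta> * q / (0 + \<eta> * q)) (at_right 0)"
    using assms by (intro tendsto_intros p) auto
  then show "((\<lambda>l. \<eta> * q / (l powr (q - 1) + \<eta> * q)) \<longlongrightarrow> 1) (at_right 0)"
    using assms by simp
qed

lemma eventually_pos_at_right_0: "\<forall>\<^sub>F l in at_right (0::real). 0 < l"
  by (rule eventually_at_right_less)

lemma sens_factor_asymp_equiv:
  assumes "1 < q" "0 < \<eta>"
  shows "sens_factor q \<eta> \<sim>[at_right 0] (\<lambda>l. l powr (q + 1) / (\<eta> * q))"
proof (rule asymp_equivI')
  have eq: "\<eta> * q / (l powr (q - 1) + \<eta> * q) = sens_factor q \<eta> l / (l powr (q + 1) / (\<eta> * q))"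
    if l: "0 < l" for l
  proof -
    have "l powr (q + 1) = l powr (q - 1) * l\<^sup>2"
      using l powr_add[of l "q - 1" 2] by (simp add: powr_numeral add.commute)
    moreover have "k / d = (p / d * s) / (p * s / k)" if "0 < p" "0 < s" "0 < k" for p s k d :: real
      using that by (cases "d = 0") (simp_all add: field_simps)
    ultimately show ?thesis using l assms by (simp add: sens_factor_eq_ratio)
  qed
  show "((\<lambda>l. sens_factor q \<eta> l / (l powr (q + 1) / (\<eta> * q))) \<longlongrightarrow> 1) (at_right 0)"
    by (rule Lim_transform_eventually[OF sens_factor_ratio_tendsto(2)[OF assms]])
      (rule eventually_mono[OF eventually_pos_at_right_0], rule eq)
qed

lemma sens_factor_smallo_square:
  assumes "1 < q" "0 < \<eta>"
  shows "sens_factor q \<eta> \<in> o[at_right 0](sens_factor q 0)"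
proof (rule smalloI_tendsto)
  show "((\<lambda>l. sens_factor q \<eta> l / sens_factor q 0 l) \<longlongrightarrow> 0) (at_right 0)"
    by (rule Lim_transform_eventually[OF sens_factor_ratio_tendsto(1)[OF assms]])
      (rule eventually_mono[OF eventually_pos_at_right_0], simp add: sens_factor_eq_ratio sens_factor_zero)
  show "\<forall>\<^sub>F l in at_right 0. sens_factor q 0 l \<noteq> 0"
    by (rule eventually_mono[OF eventually_pos_at_right_0]) (simp add: sens_factor_zero)
qed

lemma sens_factor_tendsto_0:
  assumes "1 < q" "0 < \<eta>"
  shows "(sens_factor q \<eta> \<longlongrightarrow> 0) (at_right 0)"
proof -
  have "((\<lambda>l. l powr (q - 1) / (l powr (q - 1) + \<eta> * q) * l\<^sup>2) \<longlongrightarrow> 0 * 0\<^sup>2) (at_right 0)"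
    by (intro tendsto_intros sens_factor_ratio_tendsto assms)
  then have "((\<lambda>l. l powr (q - 1) / (l powr (q - 1) + \<eta> * q) * l\<^sup>2) \<longlongrightarrow> 0) (at_right 0)" by simp
  then show ?thesis
    by (rule Lim_transform_eventually)
      (rule eventually_mono[OF eventually_pos_at_right_0], simp add: sens_factor_eq_ratio)
qed

section \<open>Sensitivity of the central path\<close>

text \<open>
  The remainder is the excess over the linear bound. By the local Lipschitz estimate it is zero for
  all small perturbations, in particular of lower order.
\<close>

lemma central_path_first_order_bound:
  fixes A :: "('n::finite) sym_mat \<Rightarrow> real^'m::finite"
  assumes A: "linear A" and \<mu>: "0 < \<mu>" and q: "1 < q" "0 \<le> \<eta>" and b: "b \<in> B"
    and Xs: "\<And>b'. b' \<in> B \<Longrightarrow> central_point q \<eta> \<mu> A C b' (Xs b')"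
  shows "\<exists>r \<in> o[at 0 within {\<Delta>b. b + \<Delta>b \<in> B}](\<lambda>\<Delta>b. norm \<Delta>b). \<forall>\<Delta>b. b + \<Delta>b \<in> B \<longrightarrow>
    norm (Xs (b + \<Delta>b) - Xs b)
      \<le> sens_const q \<eta> \<mu> A (lambda_min (Xs b)) / \<mu> * sens_factor q \<eta> (lambda_max (Xs b)) * norm \<Delta>b
        + r \<Delta>b"
proof -
  define bnd where "bnd \<Delta>b = sens_const q \<eta> \<mu> A (lambda_min (Xs b)) / \<mu>
    * sens_factor q \<eta> (lambda_max (Xs b)) * norm \<Delta>b" for \<Delta>b :: "real^'m"
  define r where "r \<Delta>b = max 0 (norm (Xs (b + \<Delta>b) - Xs b) - bnd \<Delta>b)" for \<Delta>b
  obtain \<delta> where \<delta>: "0 < \<delta>" and lip: "\<And>b' X'. central_point q \<eta> \<mu> A C b' X' \<Longrightarrow> norm (b' - b) < \<delta> \<Longrightarrow>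
    norm (X' - Xs b) \<le> 5 * lift_const A * (sens_factor q \<eta> (lambda_max (Xs b))
      / sens_factor q \<eta> (lambda_min (Xs b))) * norm (b' - b)"
    using central_point_locally_lipschitz[OF A \<mu> q bounded_lift_lift_const[OF A] Xs[OF b]] by blast
  have r0: "r \<Delta>b = 0" if "b + \<Delta>b \<in> B" "norm \<Delta>b < \<delta>" for \<Delta>b
    unfolding r_def bnd_def sens_const_mult[OF \<mu>]
    using lip[OF Xs[OF that(1)]] that(2) by simp
  have "r \<in> o[at 0 within {\<Delta>b. b + \<Delta>b \<in> B}](\<lambda>\<Delta>b. norm \<Delta>b)"
  proof (rule landau_o.smallI)
    fix c :: real assume "0 < c"
    then show "\<forall>\<^sub>F \<Delta>b in at 0 within {\<Delta>b. b + \<Delta>b \<in> B}. norm (r \<Delta>b) \<le> c * norm (norm \<Delta>b)"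
      unfolding eventually_at using \<delta> r0 by (intro exI[of _ \<delta>]) auto
  qed
  moreover have "norm (Xs (b + \<Delta>b) - Xs b) \<le> bnd \<Delta>b + r \<Delta>b" for \<Delta>b by (simp add: r_def)
  ultimately show ?thesis unfolding bnd_def by blast
qed

lemma response_sensitivity:
  fixes A :: "('n::finite) sym_mat \<Rightarrow> real^'m::finite"
  assumes A: "linear A" and \<mu>: "0 < \<mu>" and q: "1 < q" "0 \<le> \<eta>" and pd: "pos_def X"
    and X: "eigenbasis X lam e" and R: "response \<mu> A (hessian (barrier q \<eta>) X) \<Delta>b \<Delta>X"
  shows "\<bar>e k \<bullet> (mat_of \<Delta>X *v e k)\<bar>
    \<le> sens_const q \<eta> \<mu> A (lambda_min X) / \<mu> * sens_factor q \<eta> (lam k) * norm \<Delta>b"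
proof -
  have "0 < lam k" using pd by (simp add: pos_def_iff_eigenvalues_pos[OF X])
  then have nonneg: "0 \<le> lift_const A * (sens_factor q \<eta> (lam k) / sens_factor q \<eta> (lambda_min X)) * norm \<Delta>b"
    using sens_factor_pos[OF q] lambda_pos(1)[OF pd] lift_const_pos[OF A] by (simp add: less_imp_le)
  have "\<bar>bform \<Delta>X (e k) (e k)\<bar>
      \<le> lift_const A * (sens_factor q \<eta> (lam k) / sens_factor q \<eta> (lambda_min X)) * norm \<Delta>b"
    by (rule response_diagonal_bound[OF A \<mu> q bounded_lift_lift_const[OF A] pd X R])
  also have "\<dots> \<le> 5 * (lift_const A * (sens_factor q \<eta> (lam k) / sens_factor q \<eta> (lambda_min X)) * norm \<Delta>b)"
    using nonneg by simp
  finally show ?thesis 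
    unfolding bform_def sens_const_mult[OF \<mu>] by (simp only: mult.assoc)
qed

lemma central_path_sensitivity:
  fixes A :: "('n::finite) sym_mat \<Rightarrow> real^'m::finite"
  assumes q: "1 < q" "0 \<le> \<eta>" and \<mu>: "0 < \<mu>" and A: "linear A" and b: "b \<in> B"
    and Xs: "\<forall>b'\<in>B. central_point q \<eta> \<mu> A C b' (Xs b')"
  shows "(\<exists>r \<in> o[at 0 within {\<Delta>b. b + \<Delta>b \<in> B}](\<lambda>\<Delta>b. norm \<Delta>b). \<forall>\<Delta>b. b + \<Delta>b \<in> B \<longrightarrow>
        norm (Xs (b + \<Delta>b) - Xs b)
          \<le> sens_const q \<eta> \<mu> A (lambda_min (Xs b)) / \<mu> * sens_factor q \<eta> (lambda_max (Xs b)) * norm \<Delta>b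
            + r \<Delta>b) \<and>
     (0 < \<eta> \<longrightarrow> (\<forall>\<Delta>b :: real^'m. \<Delta>b \<noteq> 0 \<longrightarrow>
        sens_const q \<eta> \<mu> A (lambda_min (Xs b)) / \<mu> * sens_factor q \<eta> (lambda_max (Xs b)) * norm \<Delta>b
          < sens_const q \<eta> \<mu> A (lambda_min (Xs b)) / \<mu> * (lambda_max (Xs b))\<^sup>2 * norm \<Delta>b)) \<and>
     (\<forall>lam e \<Delta>b \<Delta>X. eigenbasis (Xs b) lam e \<and>
        response \<mu> A (hessian (barrier q \<eta>) (Xs b)) \<Delta>b \<Delta>X \<longrightarrow>
        (\<forall>k. \<bar>e k \<bullet> (mat_of \<Delta>X *v e k)\<bar>
           \<le> sens_const q \<eta> \<mu> A (lambda_min (Xs b)) / \<mu> * sens_factor q \<eta> (lam k) * norm \<Delta>b))"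
proof (intro conjI allI impI)
  have pd: "pos_def (Xs b)" using Xs b by (simp add: central_point_def)
  note l = lambda_pos[OF pd]
  show "\<exists>r \<in> o[at 0 within {\<Delta>b. b + \<Delta>b \<in> B}](\<lambda>\<Delta>b. norm \<Delta>b). \<forall>\<Delta>b. b + \<Delta>b \<in> B \<longrightarrow>
        norm (Xs (b + \<Delta>b) - Xs b)
          \<le> sens_const q \<eta> \<mu> A (lambda_min (Xs b)) / \<mu> * sens_factor q \<eta> (lambda_max (Xs b)) * norm \<Delta>b
            + r \<Delta>b"
    by (rule central_path_first_order_bound[OF A \<mu> q b]) (use Xs in blast)
  show "sens_const q \<eta> \<mu> A (lambda_min (Xs b)) / \<mu> * sens_factor q \<eta> (lambda_max (Xs b)) * norm \<Delta>b
        < sens_const q \<eta> \<mu> A (lambda_min (Xs b)) / \<mu> * (lambda_max (Xs b))\<^sup>2 * norm \<Delta>b"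
    if "0 < \<eta>" "\<Delta>b \<noteq> 0" for \<Delta>b :: "real^'m"
    using that l q \<mu> sens_const_pos[OF q \<mu> A l(1)]
    by (intro mult_strict_right_mono mult_strict_left_mono sens_factor_less_square) auto
  show "\<bar>e k \<bullet> (mat_of \<Delta>X *v e k)\<bar>
      \<le> sens_const q \<eta> \<mu> A (lambda_min (Xs b)) / \<mu> * sens_factor q \<eta> (lam k) * norm \<Delta>b"
    if "eigenbasis (Xs b) lam e \<and> response \<mu> A (hessian (barrier q \<eta>) (Xs b)) \<Delta>b \<Delta>X"
    for lam e \<Delta>b \<Delta>X k
    using response_sensitivity[OF A \<mu> q pd] that by blast
qed

theorem theorem6p1:
  "\<exists>(CA :: real \<Rightarrow> real \<Rightarrow> real \<Rightarrow> ('n::finite sym_mat \<Rightarrow> real^'m::finite) \<Rightarrow> real \<Rightarrow> real)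
    (CK :: 'n \<Rightarrow> real \<Rightarrow> real \<Rightarrow> real \<Rightarrow> ('n sym_mat \<Rightarrow> real^'m) \<Rightarrow> real \<Rightarrow> real).
    (\<forall>q \<eta> \<mu> \<A> l. 1 < q \<and> 0 \<le> \<eta> \<and> 0 < \<mu> \<and> linear \<A> \<and> 0 < l \<longrightarrow>
       0 < CA q \<eta> \<mu> \<A> l \<and> (\<forall>k. 0 < CK k q \<eta> \<mu> \<A> l)) \<and>
    (\<forall>q \<eta> \<mu> \<A> C B Xs b.
       1 < q \<and> 0 \<le> \<eta> \<and> 0 < \<mu> \<and> linear \<A> \<and> b \<in> B \<and>
       (\<forall>b'\<in>B. central_point q \<eta> \<mu> \<A> C b' (Xs b')) \<and>
       (q \<le> 2 \<or>
        (2 < q \<and> (\<exists>\<Lambda>. (\<forall>b'\<in>B. \<forall>l\<in>eigenvalues (Xs b'). l \<le> \<Lambda>) \<and>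
                       u_zero q * \<Lambda> powr (q - 1) \<le> \<eta>))) \<longrightarrow>
       (\<exists>r \<in> o[at 0 within {\<Delta>b. b + \<Delta>b \<in> B}](\<lambda>\<Delta>b. norm \<Delta>b). \<forall>\<Delta>b. b + \<Delta>b \<in> B \<longrightarrow>
          norm (Xs (b + \<Delta>b) - Xs b)
            \<le> CA q \<eta> \<mu> \<A> (lambda_min (Xs b)) / \<mu> * sens_factor q \<eta> (lambda_max (Xs b)) * norm \<Delta>b
              + r \<Delta>b) \<and>
       (0 < \<eta> \<longrightarrow> (\<forall>\<Delta>b :: real^'m. \<Delta>b \<noteq> 0 \<longrightarrow>
          CA q \<eta> \<mu> \<A> (lambda_min (Xs b)) / \<mu> * sens_factor q \<eta> (lambda_max (Xs b)) * norm \<Delta>b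
            < CA q \<eta> \<mu> \<A> (lambda_min (Xs b)) / \<mu> * (lambda_max (Xs b))\<^sup>2 * norm \<Delta>b)) \<and>
       (\<forall>lam e \<Delta>b \<Delta>X. eigenbasis (Xs b) lam e \<and>
          response \<mu> \<A> (hessian (barrier q \<eta>) (Xs b)) \<Delta>b \<Delta>X \<longrightarrow>
          (\<forall>k. \<bar>e k \<bullet> (mat_of \<Delta>X *v e k)\<bar>
             \<le> CK k q \<eta> \<mu> \<A> (lambda_min (Xs b)) / \<mu> * sens_factor q \<eta> (lam k) * norm \<Delta>b))) \<and>
    (\<forall>q \<eta>. 1 < q \<and> 0 < \<eta> \<longrightarrow>
       sens_factor q \<eta> \<sim>[at_right 0] (\<lambda>l. l powr (q + 1) / (\<eta> * q)) \<and>
       ((\<lambda>l. l powr (q + 1) / (\<eta> * q)) \<longlongrightarrow> 0) (at_right 0) \<and>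
       (sens_factor q \<eta> \<longlongrightarrow> 0) (at_right 0) \<and>
       q + 1 > 2 \<and>
       (\<forall>l>0. sens_factor q 0 l = l\<^sup>2) \<and>
       sens_factor q \<eta> \<in> o[at_right 0](sens_factor q 0)) \<and>
    (\<forall>q \<eta> \<mu> \<A> l L. 1 < q \<and> 0 \<le> \<eta> \<and> 0 < \<mu> \<and> linear \<A> \<and> 0 < l \<and> l \<le> L \<longrightarrow>
       ((\<lambda>\<eta>'. CA q \<eta>' \<mu> \<A> l / \<mu> * sens_factor q \<eta>' L)
          \<longlongrightarrow> CA q 0 \<mu> \<A> l / \<mu> * L\<^sup>2) (at_right 0) \<and>
       ((\<lambda>q'. CA q' \<eta> \<mu> \<A> l / \<mu> * sens_factor q' \<eta> L)
          \<longlongrightarrow> CA q 0 \<mu> \<A> l / \<mu> * L\<^sup>2) (at_right 1) \<and>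
       (\<forall>k. ((\<lambda>\<eta>'. CK k q \<eta>' \<mu> \<A> l / \<mu> * sens_factor q \<eta>' L)
               \<longlongrightarrow> CK k q 0 \<mu> \<A> l / \<mu> * L\<^sup>2) (at_right 0) \<and>
            ((\<lambda>q'. CK k q' \<eta> \<mu> \<A> l / \<mu> * sens_factor q' \<eta> L)
               \<longlongrightarrow> CK k q 0 \<mu> \<A> l / \<mu> * L\<^sup>2) (at_right 1)) \<and>
       (\<forall>c. ((\<lambda>\<eta>'. c / \<mu> * sens_factor q \<eta>' L) \<longlongrightarrow> c / \<mu> * L\<^sup>2) (at_right 0) \<and>
            ((\<lambda>q'. c / \<mu> * sens_factor q' \<eta> L) \<longlongrightarrow> c / ((1 + \<eta>) * \<mu>) * L\<^sup>2) (at_right 1)))"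
proof (rule exI[of _ sens_const], rule exI[of _ "\<lambda>_. sens_const"], intro conjI, goal_cases)
  case 1
  show ?case by (simp add: sens_const_pos)
next
  case 2
  show ?case by (intro allI impI, elim conjE, rule central_path_sensitivity) auto
next
  case 3
  show ?case
    by (auto intro!: sens_factor_asymp_equiv sens_factor_tendsto_0 sens_factor_smallo_square
        tendsto_divide_zero powr_tendsto_0_at_right simp: sens_factor_zero)
next
  case 4
  show ?case
    by (intro allI impI, elim conjE, intro conjI allI sens_bound_tendsto_eta_0 sens_bound_tendsto_q_1
        constant_bound_tendsto_eta_0 constant_bound_tendsto_q_1) auto
qed

end
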